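(* Let $q$ be a complex number with $0<|q|<1$. (1) Let $(A_m)_{m\ge 0}$, $(B_m)_{m\ge 0}$, $(C_m)_{m\ge 0}$ be the sequences each satisfying, for $m\ge 3$, the recursion $$X_m=qX_{m-1}+(q+q^{m-1})X_{m-2}-q^2X_{m-3}\qquad (X=A,B,C),$$ with initial values $$A_0=1,\ A_1=0,\ A_2=q;\qquad B_0=0,\ B_1=0,\ B_2=-q;\qquad C_0=0,\ C_1=q,\ C_2=0.$$ Then for every integer $m\ge 0$, $$\begin{aligned}\sum_{n=0}^{\infty}\frac{q^{n(n+2m+1)/2}}{(q;q^2)_{n+1}(q;q)_n}&=\frac{q^{-m}(q^2,q^5,q^7;q^7)_{\infty}(q^3,q^{11};q^{14})_{\infty}(-q;q)_{\infty}}{(q;q)_{\infty}}A_m\\&\quad+\frac{q^{-m}(q,q^6,q^7;q^7)_{\infty}(q^5,q^9;q^{14})_{\infty}(-q;q)_{\infty}}{(q;q)_{\infty}}B_m\\&\quad+\frac{q^{-m}(q^3,q^4,q^7;q^7)_{\infty}(q,q^{13};q^{14})_{\infty}(-q;q)_{\infty}}{(q;q)_{\infty}}C_m.\end{aligned}$$ (2) Let $(E_m)_{m\ge 0}$, $(F_m)_{m\ge 0}$, $(G_m)_{m\ge 0}$ be the sequences each satisfying, for $m\ge 3$, the recursion $$X_m=X_{m-1}+(q+q^{m-1})X_{m-2}-qX_{m-3}\qquad (X=E,F,G),$$ with initial values $$E_0=0,\ E_1=0,\ E_2=-q;\qquad F_0=1,\ F_1=1,\ F_2=1+q;\qquad G_0=0,\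 G_1=-q,\ G_2=-q.$$ Then for every integer $m\ge 0$, $$\begin{aligned}\sum_{n=0}^{\infty}\frac{q^{n(n+2m+1)/2}}{(q;q^2)_n(q;q)_n}&=\frac{(q^2,q^5,q^7;q^7)_{\infty}(q^3,q^{11};q^{14})_{\infty}(-q;q)_{\infty}}{(q;q)_{\infty}}E_m\\&\quad+\frac{(q,q^6,q^7;q^7)_{\infty}(q^5,q^9;q^{14})_{\infty}(-q;q)_{\infty}}{(q;q)_{\infty}}F_m\\&\quad+\frac{(q^3,q^4,q^7;q^7)_{\infty}(q,q^{13};q^{14})_{\infty}(-q;q)_{\infty}}{(q;q)_{\infty}}G_m.\end{aligned}$$
   Context: For $|p|<1$, $(a;p)_\infty=\prod_{k=0}^{\infty}(1-ap^k)$ and, for an integer $n\ge 0$, $(a;p)_n=\prod_{k=0}^{n-1}(1-ap^k)$. Multiple $q$-shifted factorials are products: $(a_1,\dots,a_r;p)_\infty=(a_1;p)_\infty\cdots(a_r;p)_\infty$. *)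

theory Defs
  imports "HOL-Analysis.Analysis"
begin

definition qpoch :: "complex \<Rightarrow> complex \<Rightarrow> nat \<Rightarrow> complex" where
  "qpoch a p n = (\<Prod>k<n. 1 - a * p ^ k)"

(* Meaningful for norm p < 1, where the product converges; a vanishing factor gives the value 0,
   since prodinf admits finitely many zero factors. *)
definition qpoch_inf :: "complex \<Rightarrow> complex \<Rightarrow> complex" where
  "qpoch_inf a p = (\<Prod>k. 1 - a * p ^ k)"

(* The multiple shifted factorial (a_1, ..., a_r; p)_infinity. *)
definition qpochs_inf :: "complex list \<Rightarrow> complex \<Rightarrow> complex" where
  "qpochs_inf as p = (\<Prod>a\<leftarrow>as. qpoch_inf a p)"

end

(* With phi a = (a;q)_inf, the products in question are quintuple products in base q^7 at z = q, q^2, q^3.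
   For the sums S_m and T_m of parts (1) and (2), clearing the factor 1 - q^(2n+1) gives T_m = S_m - q S_(m+2), and
   multiplying the summand by (1 - q^n)(1 - q^(2n+1)) and shifting n gives a four-term recurrence for S_m. So
   everything reduces to evaluating S_0, S_1 and T_0 (the Rogers mod 14 identities).

   These come from Bailey's lemma with a = q, rho_1 = -q, rho_2 -> infinity, applied to Bailey pairs with
   beta_n = 1/(q)_(2n+1), q^n/(q)_(2n+1), 1/(q)_(2n). All three pairs follow from a single polynomial identity
   for q-binomial coefficients (even_sum). To avoid conditionally indexed q-binomials, 1/(q)_k is replaced by
   phi(q^(k+1)) for every integer k: it vanishes by itself for k < 0 and satisfies a recurrence without exceptions.
   Bailey's lemma and the quintuple product identity are proved in a finite form by telescoping and
   then carried to the limit by dominated convergence. *)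

theory Submission
  imports Defs
begin

subsection \<open>Sums over the integers and infinite products\<close>

text \<open>The moduli 7 and 14 come from adding exponents. The Bailey pairs carry q^(12
  \<open>tri i\<close> + ...) at indices j = 3i, 3i + 1 or -3i, and the limiting Bailey lemma
  multiplies by q^(\<open>tri (j + 1)\<close>), which contributes 9 \<open>tri i\<close>. Now 12 + 9
  = 21 = 3 * 7, and the series of a quintuple product in base p has exponents 3 \<open>tri i\<close>
  + i; the linear parts then select z = q^2, q^3, q for S_0, S_1, T_0.

  The choice rho_1 = -q fits the summand: (q;q)_(2n+1) = (q;q^2)_(n+1) (q;q)_n (-q;q)_n, so the
  factor (-q;q)_n supplied by Bailey's lemma turns beta_n into the required denominator.

  A third-order recurrence needs three initial values. T_0 takes the place of S_2, because q S_2 =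
  S_0 - T_0. Part (1) is stated for q^m S_m since solving the recurrence for S_(m+3) itself would
  divide by q.\<close>

lemma has_sum_dominated:
  fixes f :: "nat \<Rightarrow> 'a \<Rightarrow> 'b::banach"
  assumes sums: "\<And>n. (f n has_sum s n) A"
    and lim: "\<And>x. x \<in> A \<Longrightarrow> (\<lambda>n. f n x) \<longlonglongrightarrow> g x"
    and bound: "\<And>n x. x \<in> A \<Longrightarrow> norm (f n x) \<le> h x"
    and h: "h summable_on A"
  shows "g summable_on A" and "s \<longlonglongrightarrow> infsum g A"
proof -
  have gh: "norm (g x) \<le> h x" if "x \<in> A" for x
    by (rule LIMSEQ_le_const2[OF tendsto_norm[OF lim[OF that]]]) (use bound[OF that] in auto)
  show g: "g summable_on A"
    using Infinite_Sum.abs_summable_on_comparison_test'[OF h gh] by (rule abs_summable_summable)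
  show "s \<longlonglongrightarrow> infsum g A"
  proof (rule LIMSEQ_I)
    fix e :: real assume "e > 0"
    \<comment> \<open>Tannery's argument: a finite \<open>F\<close> carries all but e/3 of the
      dominating sum, so \<open>s n\<close> and the limit sum each differ from their partial sums
      over \<open>F\<close> by at most e/3, uniformly in \<open>n\<close>.\<close>
    have "((\<lambda>F. sum h F) \<longlongrightarrow> infsum h A) (finite_subsets_at_top A)"
      using h by (rule infsum_tendsto)
    then have "eventually (\<lambda>F. dist (sum h F) (infsum h A) < e / 3) (finite_subsets_at_top A)"
      using \<open>e > 0\<close> by (intro tendstoD) auto
    then obtain F where F: "finite F" "F \<subseteq> A" "dist (sum h F) (infsum h A) < e / 3"
      by (auto simp: eventually_finite_subsets_at_top)
    have hF: "(h has_sum (infsum h A - sum h F)) (A - F)"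
      using F h by (intro has_sum_Diff) auto
    have tail: "norm (t - sum u F) \<le> e / 3"
      if "(u has_sum t) A" "\<And>x. x \<in> A \<Longrightarrow> norm (u x) \<le> h x" for u :: "'a \<Rightarrow> 'b" and t
    proof -
      have "(u has_sum (t - sum u F)) (A - F)"
        using F that(1) by (intro has_sum_Diff) auto
      then have "norm (t - sum u F) \<le> infsum h A - sum h F"
        using hF by (rule norm_infsum_le) (use that(2) in auto)
      also have "\<dots> \<le> e / 3" using F(3) abs_le_D2[of "sum h F - infsum h A" "e / 3"] by (simp add: dist_real_def)
      finally show ?thesis .
    qed
    have "(\<lambda>n. sum (f n) F) \<longlonglongrightarrow> sum g F"
      using F(2) by (intro tendsto_sum lim) auto
    then obtain N where N: "\<And>n. n \<ge> N \<Longrightarrow> norm (sum (f n) F - sum g F) < e / 3"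
      using LIMSEQ_D[of _ "sum g F" "e / 3"] \<open>e > 0\<close> by (metis divide_pos_pos zero_less_numeral)
    show "\<exists>N. \<forall>n\<ge>N. norm (s n - infsum g A) < e"
    proof (intro exI allI impI)
      fix n assume "n \<ge> N"
      have 1: "norm (s n - sum (f n) F) \<le> e / 3" by (rule tail[OF sums bound])
      have 2: "norm (infsum g A - sum g F) \<le> e / 3" by (rule tail[OF has_sum_infsum[OF g] gh])
      have "s n - infsum g A = (s n - sum (f n) F) + (sum (f n) F - sum g F) - (infsum g A - sum g F)"
        by simp
      also have "norm \<dots> \<le> norm (s n - sum (f n) F) + norm (sum (f n) F - sum g F) + norm (infsum g A - sum g F)"
        by (meson norm_triangle_ineq norm_triangle_ineq4 add_right_mono order_trans)
      finally show "norm (s n - infsum g A) < e" using 1 2 N[OF \<open>n \<ge> N\<close>] by linarith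
    qed
  qed
qed

lemma has_sum_finite_support:
  fixes f :: "'a \<Rightarrow> 'b::{topological_comm_monoid_add,t2_space}"
  assumes "finite B" "\<And>x. x \<notin> B \<Longrightarrow> f x = 0"
  shows "(f has_sum (\<Sum>x\<in>B. f x)) UNIV"
  by (rule has_sum_finite_neutralI[of B]) (use assms in auto)

lemma has_sum_int_shift:
  fixes f :: "int \<Rightarrow> 'b::{topological_comm_monoid_add}"
  shows "((\<lambda>k. f (k + c)) has_sum s) UNIV \<longleftrightarrow> (f has_sum s) UNIV"
  by (rule has_sum_reindex_bij_witness[of _ "\<lambda>k. k - c" "\<lambda>k. k + c"]) auto

lemma has_sum_int_reflect:
  fixes f :: "int \<Rightarrow> 'b::{topological_comm_monoid_add}"
  shows "((\<lambda>k. f (c - k)) has_sum s) UNIV \<longleftrightarrow> (f has_sum s) UNIV"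
  by (rule has_sum_reindex_bij_witness[of _ "\<lambda>k. c - k" "\<lambda>k. c - k"]) auto

text \<open>This is how certificates are used below: finite support makes both shifted copies finite
  sums, so no convergence question arises.\<close>

lemma has_sum_telescope_int:
  fixes G :: "int \<Rightarrow> 'b::real_normed_algebra_1"
  assumes "finite B" "\<And>k. k \<notin> B \<Longrightarrow> G k = 0"
  shows "((\<lambda>k. G (k + 1) - G k) has_sum 0) UNIV"
proof -
  have "(G has_sum (\<Sum>x\<in>B. G x)) UNIV"
    using assms by (rule has_sum_finite_support)
  moreover from this have "((\<lambda>k. G (k + 1)) has_sum (\<Sum>x\<in>B. G x)) UNIV"
    by (simp only: has_sum_int_shift)
  ultimately have "((\<lambda>k. G (k + 1) + - G k) has_sum ((\<Sum>x\<in>B. G x) + - (\<Sum>x\<in>B. G x))) UNIV"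
    by (intro has_sum_add has_sum_uminusI)
  then show ?thesis by simp
qed

text \<open>The binomial coefficient (k choose 2), extended to negative k. Keeping it as an opaque
  integer makes all theta exponents linear in \<open>tri k\<close> and \<open>k\<close>; shifts,
  reflections and dilations of the index then go through \<open>tri_add\<close>,
  \<open>tri_uminus\<close> and \<open>tri_triple\<close>.\<close>

definition tri :: "int \<Rightarrow> int" where
  "tri k = k * (k - 1) div 2"

lemma two_tri: "2 * tri k = k * k - k"
  by (simp add: tri_def algebra_simps)

lemma tri_nonneg: "tri k \<ge> 0"
proof -
  have "0 \<le> k * (k - 1)" by (cases "k \<ge> 1") (auto simp: zero_le_mult_iff)
  then show ?thesis by (simp add: tri_def)
qed

lemma tri_add: "tri (a + b) = tri a + tri b + a * b"
  using two_tri[of "a + b"] two_tri[of a] two_tri[of b] by (simp add: algebra_simps)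

lemma tri_uminus: "tri (- a) = tri a + a"
  using two_tri[of "- a"] two_tri[of a] by (simp add: algebra_simps)

lemma tri_simps [simp]: "tri 0 = 0" "tri 1 = 0" "tri 2 = 1"
  by (simp_all add: tri_def)

lemma tri_triple: "tri (3 * a) = 9 * tri a + 3 * a"
  using two_tri[of "3 * a"] two_tri[of a] by (simp add: algebra_simps)

lemma tri_nat: "tri (int n + 1) = int (n * (n + 1) div 2)"
  by (simp add: tri_def zdiv_int algebra_simps)

lemma summable_tri_nat:
  fixes a r :: real
  assumes "0 < r" "r < 1" "0 < a"
  shows "summable (\<lambda>n. a ^ n * r ^ nat (tri (int n)))"
proof -
  have "(\<lambda>n. a * r ^ n) \<longlonglongrightarrow> a * 0"
    using assms by (intro tendsto_intros LIMSEQ_realpow_zero) auto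
  then have "eventually (\<lambda>n. a * r ^ n < 1 / 2) sequentially"
    by (rule order_tendstoD) auto
  then obtain N where N: "\<And>n. n \<ge> N \<Longrightarrow> a * r ^ n < 1 / 2"
    by (auto simp: eventually_sequentially)
  show ?thesis
  proof (rule summable_ratio_test[of "1/2" N])
    fix n assume "n \<ge> N"
    have "tri (int (Suc n)) = tri (int n) + int n"
      using tri_add[of "int n" 1] by (simp add: algebra_simps)
    moreover have "tri (int n) \<ge> 0" by (rule tri_nonneg)
    ultimately have t: "nat (tri (int (Suc n))) = nat (tri (int n)) + n" by simp
    have "norm (a ^ Suc n * r ^ nat (tri (int (Suc n)))) = (a * r ^ n) * norm (a ^ n * r ^ nat (tri (int n)))"
      using assms by (simp only: t power_add power_Suc norm_mult) (simp add: mult_ac)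
    also have "\<dots> \<le> 1 / 2 * norm (a ^ n * r ^ nat (tri (int n)))"
      using N[OF \<open>n \<ge> N\<close>] by (intro mult_right_mono) auto
    finally show "norm (a ^ Suc n * r ^ nat (tri (int (Suc n)))) \<le> 1 / 2 * norm (a ^ n * r ^ nat (tri (int n)))" .
  qed simp
qed

text \<open>The bilateral theta series splits at 0. Since \<open>tri (- n) = tri n + n\<close>, the
  negative half is a one-sided series of the same kind with \<open>q / z\<close> in place of
  \<open>z\<close>.\<close>

lemma tri_summable:
  fixes z q :: complex
  assumes "z \<noteq> 0" "q \<noteq> 0" "norm q < 1"
  shows "(\<lambda>k. z powi k * q powi tri k) summable_on UNIV"
proof -
  have nn: "(\<lambda>n. w ^ n * q powi tri (int n)) summable_on UNIV" if "w \<noteq> 0" for w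
  proof (rule norm_summable_imp_summable_on)
    have "norm (w ^ n * q powi tri (int n)) = norm w ^ n * norm q ^ nat (tri (int n))" for n
      using tri_nonneg[of "int n"] by (simp add: norm_mult norm_power norm_power_int power_int_def)
    then show "summable (\<lambda>n. norm (w ^ n * q powi tri (int n)))"
      using summable_tri_nat[of "norm q" "norm w"] assms that by simp
  qed
  have pos: "(\<lambda>k. z powi k * q powi tri k) summable_on {0..}"
  proof -
    have "bij_betw int UNIV {0..}"
      by (rule bij_betwI[of _ _ _ nat]) auto
    from summable_on_reindex_bij_betw[OF this, of "\<lambda>k. z powi k * q powi tri k"] nn[OF assms(1)]
    show ?thesis by simp
  qed
  have neg: "(\<lambda>k. z powi k * q powi tri k) summable_on {..0}"
  proof -
    have b: "bij_betw (\<lambda>n. - int n) UNIV {..0}"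
      by (rule bij_betwI[of _ _ _ "\<lambda>k. nat (- k)"]) auto
    have "z powi (- int n) * q powi tri (- int n) = (q / z) ^ n * q powi tri (int n)" for n
      using assms by (simp add: tri_uminus power_int_add power_int_minus field_simps)
    with nn[of "q / z"] assms have "(\<lambda>n. z powi (- int n) * q powi tri (- int n)) summable_on UNIV"
      by simp
    with summable_on_reindex_bij_betw[OF b, of "\<lambda>k. z powi k * q powi tri k"] show ?thesis by simp
  qed
  have "(\<lambda>k. z powi k * q powi tri k) summable_on ({0..} \<union> {..0})"
    by (rule summable_on_union[OF pos neg])
  moreover have "{0..} \<union> {..(0::int)} = UNIV" by auto
  ultimately show ?thesis by simp
qed

lemma tri_abs_summable:
  fixes q :: complex
  assumes "q \<noteq> 0" "norm q < 1" "a > 0"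
  shows "(\<lambda>k. norm (q powi (a * tri k + b * k + c))) summable_on UNIV"
proof -
  have "norm (q powi a) < 1"
    using assms by (cases a) (auto simp: norm_power power_int_def norm_inverse power_less_one_iff)
  then have "(\<lambda>k. (q powi b) powi k * (q powi a) powi tri k) summable_on UNIV"
    using assms by (intro tri_summable) auto
  then have "(\<lambda>k. q powi c * ((q powi b) powi k * (q powi a) powi tri k)) summable_on UNIV"
    by (rule summable_on_cmult_right)
  moreover have "q powi c * ((q powi b) powi k * (q powi a) powi tri k) = q powi (a * tri k + b * k + c)" for k
    using assms by (simp add: power_int_add power_int_mult)
  ultimately show ?thesis
    by (simp flip: summable_on_iff_abs_summable_on_complex)
qed

section \<open>Finite and infinite q-shifted factorials\<close>

lemma qpoch_0 [simp]: "qpoch a q 0 = 1"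
  by (simp add: qpoch_def)

lemma qpoch_Suc: "qpoch a q (Suc n) = qpoch a q n * (1 - a * q ^ n)"
  by (simp add: qpoch_def)

lemma qpoch_inf_convergent:
  fixes a q :: complex
  assumes "norm q < 1"
  shows "convergent_prod (\<lambda>k. 1 - a * q ^ k)"
proof -
  have "summable (\<lambda>k. norm (a * q ^ k))"
    using assms unfolding norm_mult norm_power by (intro summable_mult summable_geometric) simp
  then have "abs_convergent_prod (\<lambda>k. 1 - a * q ^ k)"
    by (simp add: abs_convergent_prod_conv_summable)
  then show ?thesis by (rule abs_convergent_prod_imp_convergent_prod)
qed

lemma qpoch_inf_split:
  assumes "norm q < 1"
  shows "qpoch_inf a q = qpoch a q n * qpoch_inf (a * q ^ n) q"
proof -
  have "(\<lambda>k. 1 - a * q ^ k) has_prod (qpoch a q n * qpoch_inf (a * q ^ n) q)"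
    using has_prod_ignore_initial_segment'[OF qpoch_inf_convergent[OF assms], of a n]
    by (simp add: qpoch_def qpoch_inf_def power_add mult_ac)
  then show ?thesis
    by (simp add: qpoch_inf_def has_prod_iff)
qed

lemma qpoch_inf_step:
  assumes "norm q < 1"
  shows "qpoch_inf a q = (1 - a) * qpoch_inf (a * q) q"
  using qpoch_inf_split[OF assms, of a 1] by (simp add: qpoch_def)

lemma qpoch_LIMSEQ:
  assumes "norm q < 1"
  shows "qpoch a q \<longlonglongrightarrow> qpoch_inf a q"
proof -
  have "(\<lambda>n. qpoch a q (Suc n)) \<longlonglongrightarrow> qpoch_inf a q"
    using convergent_prod_LIMSEQ[OF qpoch_inf_convergent[OF assms, of a]]
    by (simp add: qpoch_def qpoch_inf_def lessThan_Suc_atMost del: prod.lessThan_Suc)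
  then show ?thesis by (rule LIMSEQ_imp_Suc)
qed

lemma qpoch_inf_nonzero:
  assumes "norm q < 1" "\<And>k. a * q ^ k \<noteq> 1"
  shows "qpoch_inf a q \<noteq> 0"
  unfolding qpoch_inf_def by (rule prodinf_nonzero[OF qpoch_inf_convergent]) (use assms in auto)

lemma qpoch_inf_nonzero':
  assumes "norm q < 1" "norm a < 1"
  shows "qpoch_inf a q \<noteq> 0"
proof (rule qpoch_inf_nonzero)
  fix k
  have "norm (a * q ^ k) \<le> norm a * 1"
    unfolding norm_mult norm_power using assms by (intro mult_left_mono power_le_one) auto
  with assms show "a * q ^ k \<noteq> 1" by fastforce
qed (use assms in auto)

lemma qpoch_inf_shift_tendsto_1:
  assumes "norm q < 1"
  shows "(\<lambda>n. qpoch_inf (a * q ^ n) q) \<longlonglongrightarrow> 1"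
proof -
  have "(\<lambda>n. norm a * norm q ^ n) \<longlonglongrightarrow> norm a * 0"
    using assms by (intro tendsto_intros LIMSEQ_realpow_zero) auto
  then have "eventually (\<lambda>n. norm a * norm q ^ n < 1) sequentially"
    by (rule order_tendstoD) auto
  then obtain N where "norm (a * q ^ N) < 1"
    by (auto simp: eventually_sequentially norm_mult norm_power)
  \<comment> \<open>For \<open>a\<close> itself the infinite product may vanish; after a shift by
    \<open>N\<close> its parameter has norm below 1, so it is nonzero and can be divided by.\<close>
  define b where "b = a * q ^ N"
  have nz: "qpoch_inf b q \<noteq> 0"
    using assms \<open>norm (a * q ^ N) < 1\<close> by (intro qpoch_inf_nonzero') (auto simp: b_def)
  have nz': "qpoch b q n \<noteq> 0" for n
    using qpoch_inf_split[OF assms, of b n] nz by auto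
  have "(\<lambda>n. qpoch_inf b q / qpoch b q n) \<longlonglongrightarrow> qpoch_inf b q / qpoch_inf b q"
    by (intro tendsto_intros qpoch_LIMSEQ assms nz)
  moreover have "qpoch_inf b q / qpoch b q n = qpoch_inf (a * q ^ (n + N)) q" for n
    using qpoch_inf_split[OF assms, of b n] nz'[of n] by (simp add: b_def power_add mult_ac)
  ultimately have "(\<lambda>n. qpoch_inf (a * q ^ (n + N)) q) \<longlonglongrightarrow> 1"
    using nz by simp
  then show ?thesis by (rule LIMSEQ_offset)
qed

lemma qpoch_inf_square:
  assumes "norm q < 1"
  shows "qpoch_inf (a\<^sup>2) (q\<^sup>2) = qpoch_inf a q * qpoch_inf (- a) q"
proof (rule LIMSEQ_unique)
  have q2: "norm (q\<^sup>2) < 1" using assms by (simp add: norm_power power_less_one_iff)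
  show "qpoch (a\<^sup>2) (q\<^sup>2) \<longlonglongrightarrow> qpoch_inf (a\<^sup>2) (q\<^sup>2)"
    by (rule qpoch_LIMSEQ[OF q2])
  have "qpoch (a\<^sup>2) (q\<^sup>2) n = qpoch a q n * qpoch (- a) q n" for n
    by (simp add: qpoch_def power2_eq_square algebra_simps power_mult_distrib flip: prod.distrib)
  then show "qpoch (a\<^sup>2) (q\<^sup>2) \<longlonglongrightarrow> qpoch_inf a q * qpoch_inf (- a) q"
    using tendsto_mult[OF qpoch_LIMSEQ[OF assms, of a] qpoch_LIMSEQ[OF assms, of "- a"]] by presburger
qed

lemma qpoch_inf_bisect:
  assumes "norm q < 1"
  shows "qpoch_inf a q = qpoch_inf a (q\<^sup>2) * qpoch_inf (a * q) (q\<^sup>2)"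
proof (rule LIMSEQ_unique)
  have q2: "norm (q\<^sup>2) < 1" using assms by (simp add: norm_power power_less_one_iff)
  show "(\<lambda>n. qpoch a q (2 * n)) \<longlonglongrightarrow> qpoch_inf a q"
    using LIMSEQ_subseq_LIMSEQ[OF qpoch_LIMSEQ[OF assms, of a], of "\<lambda>n. 2 * n"]
    by (simp add: strict_mono_def o_def)
  have "qpoch a q (2 * n) = qpoch a (q\<^sup>2) n * qpoch (a * q) (q\<^sup>2) n" for n
    by (induction n) (simp_all add: qpoch_Suc power_mult power_mult_distrib algebra_simps flip: power_mult)
  then show "(\<lambda>n. qpoch a q (2 * n)) \<longlonglongrightarrow> qpoch_inf a (q\<^sup>2) * qpoch_inf (a * q) (q\<^sup>2)"
    using tendsto_mult[OF qpoch_LIMSEQ[OF q2, of a] qpoch_LIMSEQ[OF q2, of "a * q"]] by presburger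
qed

text \<open>A summand may be changed by an antisymmetric amount under the reflection k to c - k
  without changing its sum. The pair with beta_n = q^n/(q;q)_(2n+1) needs this; a telescoping term
  does the same job for the others.\<close>

lemma has_sum_antisymmetrize:
  fixes H :: "int \<Rightarrow> 'b::real_normed_algebra_1"
  assumes "finite B" "\<And>k. k \<notin> B \<Longrightarrow> H k = 0"
  shows "((\<lambda>k. H k - H (c - k)) has_sum 0) UNIV"
proof -
  have "(H has_sum (\<Sum>x\<in>B. H x)) UNIV"
    using assms by (rule has_sum_finite_support)
  moreover from this have "((\<lambda>k. H (c - k)) has_sum (\<Sum>x\<in>B. H x)) UNIV"
    by (simp only: has_sum_int_reflect)
  ultimately have "((\<lambda>k. H k + - H (c - k)) has_sum ((\<Sum>x\<in>B. H x) + - (\<Sum>x\<in>B. H x))) UNIV"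
    by (intro has_sum_add has_sum_uminusI)
  then show ?thesis by simp
qed

lemma has_sum_cancel:
  fixes c :: "'b::{topological_semigroup_mult, field}"
  assumes "((\<lambda>x. c * f x) has_sum (c * S)) A" "c \<noteq> 0"
  shows "(f has_sum S) A"
  using assms by (simp add: has_sum_cmult_right_iff)

text \<open>The odd powers of q contribute (q;q^2)_(n+1), the even ones (q^2;q^2)_n = (q;q)_n
  (-q;q)_n.\<close>

lemma qpoch_odd: "qpoch q q (2 * n + 1) = qpoch q (q\<^sup>2) (n + 1) * qpoch q q n * qpoch (- q) q n"
proof (induction n)
  case (Suc n)
  have "1 - q * q ^ (2 * n + 1) = (1 - q * q ^ n) * (1 - (- q) * q ^ n)"
    by (subst power_add, subst mult_2, subst power_add) (simp add: algebra_simps)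
  moreover have "1 - q * q ^ (2 * n + 2) = 1 - q * (q\<^sup>2) ^ (n + 1)"
  proof -
    have "2 * n + 2 = 2 * (n + 1)" by simp
    then show ?thesis by (simp only: power_mult)
  qed
  moreover have "qpoch q q (2 * Suc n + 1) = qpoch q q (2 * n + 1) * (1 - q * q ^ (2 * n + 1)) * (1 - q * q ^ (2 * n + 2))"
    by (simp add: qpoch_Suc)
  moreover have "qpoch q (q\<^sup>2) (Suc n + 1) = qpoch q (q\<^sup>2) (n + 1) * (1 - q * (q\<^sup>2) ^ (n + 1))"
    by (simp add: qpoch_Suc)
  ultimately have f1: "qpoch q q (2 * Suc n + 1) = qpoch q q (2 * n + 1) * ((1 - q * q ^ n) * (1 - (- q) * q ^ n)) * (1 - q * (q\<^sup>2) ^ (n + 1))"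
    and f2: "qpoch q (q\<^sup>2) (Suc n + 1) = qpoch q (q\<^sup>2) (n + 1) * (1 - q * (q\<^sup>2) ^ (n + 1))"
    by (simp_all only:)
  show ?case unfolding f1 f2 Suc qpoch_Suc[of _ q n] by (simp only: mult_ac)
qed (simp add: qpoch_def)

lemma qpoch_even: "qpoch q q (2 * n) = qpoch q (q\<^sup>2) n * qpoch q q n * qpoch (- q) q n"
proof (cases n)
  case (Suc m)
  have "qpoch q q (2 * n) = qpoch q q (2 * m + 1) * (1 - q * q ^ (2 * m + 1))"
    by (simp add: Suc qpoch_Suc)
  also have "1 - q * q ^ (2 * m + 1) = (1 - q * q ^ m) * (1 - (- q) * q ^ m)"
    by (subst power_add, subst mult_2, subst power_add) (simp add: algebra_simps del: power_add)
  finally show ?thesis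
    unfolding qpoch_odd by (simp add: Suc qpoch_Suc[of _ q m] mult_ac)
qed simp

lemma has_sum_sum_atMost:
  fixes f :: "nat \<Rightarrow> 'a \<Rightarrow> 'b::{topological_comm_monoid_add}"
  assumes "\<And>n. (f n has_sum s n) A"
  shows "((\<lambda>x. \<Sum>n\<le>L. f n x) has_sum (\<Sum>n\<le>L. s n)) A"
  by (induction L) (auto intro!: has_sum_add assms)

subsection \<open>The quintuple product identity\<close>

text \<open>A locale, because the quintuple product identity is proved in base q and later
  interpreted in base \<open>q ^ 7\<close>.\<close>

locale qbase =
  fixes q :: complex
  assumes q0: "q \<noteq> 0" and q1: "norm q < 1"
begin

text \<open>\<open>qrec k / qrec 0\<close> is \<open>1 / (q;q)_k\<close> for \<open>k \<ge> 0\<close> and \<open>0\<close> for \<open>k < 0\<close>.\<close>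

definition qrec :: "int \<Rightarrow> complex" where
  "qrec k = qpoch_inf (q powi (k + 1)) q"

lemma qpoch_inf_powi_step: "qpoch_inf (a * q powi k) q = (1 - a * q powi k) * qpoch_inf (a * q powi (k + 1)) q"
  using qpoch_inf_step[OF q1, of "a * q powi k"] q0 by (simp add: power_int_add mult_ac)

lemma qrec_step: "qrec (k - 1) = (1 - q powi k) * qrec k"
  using qpoch_inf_powi_step[of 1 k] by (simp add: qrec_def)

lemma qrec_neg: "k < 0 \<Longrightarrow> qrec k = 0"
proof -
  assume "k < 0"
  define n where "n = nat (- k - 1)"
  have "q powi (k + 1) * q ^ n = q powi (k + 1 + int n)"
    using q0 by (simp add: power_int_add)
  also have "\<dots> = 1" using \<open>k < 0\<close> by (simp add: n_def)
  finally have "qpoch (q powi (k + 1)) q (Suc n) = 0"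
    by (simp add: qpoch_Suc)
  then show ?thesis
    unfolding qrec_def using qpoch_inf_split[OF q1, of "q powi (k + 1)" "Suc n"] by simp
qed

lemma powi_ne_1:
  assumes "k \<noteq> 0"
  shows "q powi k \<noteq> 1"
proof
  assume "q powi k = 1"
  then have "q ^ nat \<bar>k\<bar> = 1"
    by (cases "k \<ge> 0") (simp_all add: power_int_def power_inverse)
  then have "norm q ^ nat \<bar>k\<bar> = 1"
    by (simp flip: norm_power)
  moreover have "norm q ^ nat \<bar>k\<bar> < 1"
    using assms q1 by (simp add: power_less_one_iff)
  ultimately show False by simp
qed

lemma qrec_nonzero: "k \<ge> 0 \<Longrightarrow> qrec k \<noteq> 0"
  unfolding qrec_def
proof (rule qpoch_inf_nonzero[OF q1])
  fix i assume "k \<ge> 0"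
  then show "q powi (k + 1) * q ^ i \<noteq> 1"
    using powi_ne_1[of "k + 1 + int i"] q0 by (simp add: power_int_add)
qed

lemma qpoch_inf_powi_tendsto: "(\<lambda>n. qpoch_inf (a * q powi (int n + c)) q) \<longlonglongrightarrow> 1"
  using qpoch_inf_shift_tendsto_1[OF q1, of "a * q powi c"] q0
  by (simp add: power_int_add mult_ac)

lemma qrec_tendsto: "(\<lambda>n. qrec (int n + c)) \<longlonglongrightarrow> 1"
  using qpoch_inf_powi_tendsto[of 1 "c + 1"] by (simp add: qrec_def add.assoc)

lemma qpoch_inf_powi_bounded: "\<exists>C>0. \<forall>k\<ge>0. norm (qpoch_inf (a * q powi k) q) \<le> C"
proof -
  have "Bseq (\<lambda>n. qpoch_inf (a * q powi (int n + 0)) q)"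
    using qpoch_inf_powi_tendsto by (rule convergent_imp_Bseq[OF convergentI])
  then obtain C where C: "C > 0" "\<And>n. norm (qpoch_inf (a * q powi (int n)) q) \<le> C"
    by (auto simp: Bseq_def)
  have "norm (qpoch_inf (a * q powi k) q) \<le> C" if "k \<ge> 0" for k
    using C(2)[of "nat k"] that by simp
  with C(1) show ?thesis by blast
qed

lemma qrec_bounded: "\<exists>C>0. \<forall>k. norm (qrec k) \<le> C"
proof -
  obtain C where "C > 0" and C: "\<forall>k\<ge>0. norm (qpoch_inf (q * q powi k) q) \<le> C"
    using qpoch_inf_powi_bounded[of q] by auto
  have "norm (qrec k) \<le> C" for k
  proof (cases "k < 0")
    case True
    then show ?thesis using qrec_neg \<open>C > 0\<close> by simp
  next
    case False
    then show ?thesis using C q0 by (auto simp: qrec_def power_int_add mult.commute)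
  qed
  with \<open>C > 0\<close> show ?thesis by blast
qed

lemma qrec_0: "qrec 0 = qpoch_inf q q"
  by (simp add: qrec_def)

text \<open>Here \<open>3 * tri k + k\<close> is the pentagonal number k(3k - 1)/2.\<close>

definition quint_summand :: "complex \<Rightarrow> int \<Rightarrow> complex" where
  "quint_summand z k = z powi (3 * k) * q powi (3 * tri k + k) * (1 - z * q powi k)"

text \<open>Up to normalization, this is the finite quintuple product identity of Chen, Chu and Gu with
  \<open>z\<close> replaced by \<open>- z * q powi (- m)\<close> and the summation index shifted by \<open>m\<close>.\<close>

definition quint_weight :: "complex \<Rightarrow> int \<Rightarrow> int \<Rightarrow> int \<Rightarrow> complex" where
  "quint_weight z m n k = qrec (n - k) * qrec (m + k) * qpoch_inf (z\<^sup>2 * q powi (n + k + 1)) q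
     * qpoch_inf (inverse (z\<^sup>2) * q powi (m - k + 1)) q"

text \<open>The part of the closed form that depends on \<open>m\<close> and \<open>n\<close>. Each
  factor tends to 1, so only the constant fixed by the case m = n = 0 survives in the limit.\<close>

definition quint_const :: "complex \<Rightarrow> int \<Rightarrow> int \<Rightarrow> complex" where
  "quint_const z m n = qrec (m + n) * qpoch_inf (- z * q powi (n + 1)) q
     * qpoch_inf (- inverse z * q powi (m + 1)) q"

lemma quint_weight_support: "k \<notin> {-m..n} \<Longrightarrow> quint_weight z m n k = 0"
  by (auto simp: quint_weight_def qrec_neg)

text \<open>The contiguity relations lower an index: in this direction they only multiply by
  polynomial factors, so they also hold where the weight vanishes.\<close>

lemma quint_weight_pred_n:
  "quint_weight z m (n - 1) k = (1 - q powi (n - k)) * (1 - z\<^sup>2 * q powi (n + k)) * quint_weight z m n k"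
proof -
  have e: "n - 1 - k = (n - k) - 1" "n - 1 + k + 1 = n + k" by simp_all
  show ?thesis unfolding quint_weight_def e qrec_step qpoch_inf_powi_step[of "z\<^sup>2" "n + k"]
    by (simp only: mult_ac)
qed

lemma quint_weight_pred_m:
  "quint_weight z (m - 1) n k = (1 - q powi (m + k)) * (1 - inverse (z\<^sup>2) * q powi (m - k)) * quint_weight z m n k"
proof -
  have e: "m - 1 + k = (m + k) - 1" "m - 1 - k + 1 = m - k" by simp_all
  show ?thesis unfolding quint_weight_def e qrec_step qpoch_inf_powi_step[of "inverse (z\<^sup>2)" "m - k"]
    by (simp only: mult_ac)
qed

lemma quint_const_pred_n:
  "quint_const z m (n - 1) = (1 - q powi (m + n)) * (1 + z * q powi n) * quint_const z m n"
proof -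
  have e: "m + (n - 1) = (m + n) - 1" "n - 1 + 1 = n" by simp_all
  show ?thesis unfolding quint_const_def e qrec_step qpoch_inf_powi_step[of "- z" n]
    by simp
qed

lemma quint_const_pred_m:
  "quint_const z (m - 1) n = (1 - q powi (m + n)) * (1 + inverse z * q powi m) * quint_const z m n"
proof -
  have e: "(m - 1) + n = (m + n) - 1" "m - 1 + 1 = m" by simp_all
  show ?thesis unfolding quint_const_def e qrec_step qpoch_inf_powi_step[of "- inverse z" m]
    by simp
qed

text \<open>The WZ certificate. Its rational multiplier is absorbed into the shifted arguments of
  \<open>qrec\<close> and \<open>qpoch_inf\<close>, which avoids poles and makes the finite support
  visible. The same certificate serves both directions, with multiplier -q^n for \<open>n\<close>
  and -q^m/z^2 for \<open>m\<close>.\<close>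

definition quint_cert :: "complex \<Rightarrow> int \<Rightarrow> int \<Rightarrow> int \<Rightarrow> complex" where
  "quint_cert z m n k = q powi (- k) * z powi (3 * k) * q powi (3 * tri k + k) *
     (qrec (n - k) * qrec (m + k - 1) * qpoch_inf (z\<^sup>2 * q powi (n + k)) q
     * qpoch_inf (inverse (z\<^sup>2) * q powi (m - k + 1)) q)"

lemma quint_cert_support: "k \<notin> {-m..n} \<Longrightarrow> quint_cert z m n k = 0"
  by (auto simp: quint_cert_def qrec_neg)

lemma quint_cert_eq:
  "quint_cert z m n k = q powi (- k) * z powi (3 * k) * q powi (3 * tri k + k) *
     (1 - q powi (m + k)) * (1 - z\<^sup>2 * q powi (n + k)) * quint_weight z m n k"
  unfolding quint_cert_def quint_weight_def qrec_step qpoch_inf_powi_step[of "z\<^sup>2" "n + k"]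
  by (simp only: mult_ac)

lemma quint_cert_succ:
  assumes "z \<noteq> 0"
  shows "quint_cert z m n (k + 1) = z^3 * q powi (2 * k) * z powi (3 * k) * q powi (3 * tri k + k) *
     (1 - q powi (n - k)) * (1 - inverse (z\<^sup>2) * q powi (m - k)) * quint_weight z m n k"
proof -
  have e: "n - (k + 1) = (n - k) - 1" "m + (k + 1) - 1 = m + k" "n + (k + 1) = n + k + 1" "m - (k + 1) + 1 = m - k"
    by simp_all
  have h1: "q powi (- (k + 1)) * q powi (3 * tri (k + 1) + (k + 1)) = q powi (2 * k) * q powi (3 * tri k + k)"
    using q0 by (simp add: tri_add algebra_simps flip: power_int_add)
  have h2: "z powi (3 * (k + 1)) = z ^ 3 * z powi (3 * k)"
    using assms by (simp add: power_int_add distrib_left)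
  have "q powi (- (k + 1)) * z powi (3 * (k + 1)) * q powi (3 * tri (k + 1) + (k + 1))
      = z powi (3 * (k + 1)) * (q powi (- (k + 1)) * q powi (3 * tri (k + 1) + (k + 1)))"
    by (simp only: mult_ac)
  then have w: "q powi (- (k + 1)) * z powi (3 * (k + 1)) * q powi (3 * tri (k + 1) + (k + 1))
      = z ^ 3 * q powi (2 * k) * z powi (3 * k) * q powi (3 * tri k + k)"
    unfolding h1 h2 by (simp only: mult_ac)
  show ?thesis
    unfolding quint_cert_def w unfolding quint_weight_def e qrec_step qpoch_inf_powi_step[of "inverse (z\<^sup>2)" "m - k"]
    by (simp only: mult_ac)
qed

lemma quint_step_n:
  assumes z: "z \<noteq> 0"
  shows "(1 - q powi (m + n)) * (1 + z * q powi n) * (quint_summand z k * quint_weight z m n k)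
     - quint_summand z k * quint_weight z m (n - 1) k
     = - (q powi n) * (quint_cert z m n (k + 1) - quint_cert z m n k)"
proof -
  define x N M where "x = q powi k" and "N = q powi n" and "M = q powi m"
  have x: "x \<noteq> 0" using q0 by (simp add: x_def)
  have pw: "q powi (m + n) = M * N" "q powi (n - k) = N / x" "q powi (n + k) = N * x"
    "q powi (m + k) = M * x" "q powi (m - k) = M / x" "q powi (- k) = 1 / x" "q powi (2 * k) = x\<^sup>2"
    "q powi n = N" "q powi k = x"
    using q0 by (simp_all add: x_def N_def M_def power_int_add power_int_diff power_int_minus field_simps power_int_mult power2_eq_square mult_2)
  define W where "W = z powi (3 * k) * q powi (3 * tri k + k) * quint_weight z m n k"
  \<comment> \<open>What remains of the claim once the common factor \<open>W\<close> is removed: a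
    rational identity in \<open>x\<close>, \<open>N\<close>, \<open>M\<close> and
    \<open>z\<close>.\<close>
  have "(1 - M * N) * (1 + z * N) * (1 - z * x) - (1 - z * x) * ((1 - N / x) * (1 - z\<^sup>2 * (N * x)))
    = - N * (z^3 * x\<^sup>2 * (1 - N / x) * (1 - inverse (z\<^sup>2) * (M / x)) - 1 / x * (1 - M * x) * (1 - z\<^sup>2 * (N * x)))"
    using x z by (simp add: field_simps) algebra
  from arg_cong[OF this, of "\<lambda>t. t * W"] show ?thesis
    unfolding quint_cert_succ[OF z] unfolding quint_weight_pred_n quint_cert_eq quint_summand_def pw W_def
    by (simp only: algebra_simps)
qed

lemma quint_step_m:
  assumes z: "z \<noteq> 0"
  shows "(1 - q powi (m + n)) * (1 + inverse z * q powi m) * (quint_summand z k * quint_weight z m n k)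
     - quint_summand z k * quint_weight z (m - 1) n k
     = - (q powi m / z\<^sup>2) * (quint_cert z m n (k + 1) - quint_cert z m n k)"
proof -
  define x N M where "x = q powi k" and "N = q powi n" and "M = q powi m"
  have x: "x \<noteq> 0" using q0 by (simp add: x_def)
  have pw: "q powi (m + n) = M * N" "q powi (n - k) = N / x" "q powi (n + k) = N * x"
    "q powi (m + k) = M * x" "q powi (m - k) = M / x" "q powi (- k) = 1 / x" "q powi (2 * k) = x\<^sup>2"
    "q powi m = M" "q powi k = x"
    using q0 by (simp_all add: x_def N_def M_def power_int_add power_int_diff power_int_minus field_simps power_int_mult power2_eq_square mult_2)
  define W where "W = z powi (3 * k) * q powi (3 * tri k + k) * quint_weight z m n k"
  have "(1 - M * N) * (1 + inverse z * M) * (1 - z * x) - (1 - z * x) * ((1 - M * x) * (1 - inverse (z\<^sup>2) * (M / x)))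
    = - (M / z\<^sup>2) * (z^3 * x\<^sup>2 * (1 - N / x) * (1 - inverse (z\<^sup>2) * (M / x)) - 1 / x * (1 - M * x) * (1 - z\<^sup>2 * (N * x)))"
    using x z by (simp add: field_simps) algebra
  from arg_cong[OF this, of "\<lambda>t. t * W"] show ?thesis
    unfolding quint_cert_succ[OF z] unfolding quint_weight_pred_m quint_cert_eq quint_summand_def pw W_def
    by (simp only: algebra_simps)
qed

text \<open>Summed over k, the certificate terms cancel, so the sum obeys the same first-order
  recurrence as \<open>quint_const\<close>. Going upwards means dividing by \<open>c\<close>; the
  factor \<open>K\<close> passes through unchanged.\<close>

lemma quint_has_sum_step:
  assumes sum: "((\<lambda>k. quint_summand z k * quint_weight z m' n' k) has_sum (K * quint_const z m' n')) UNIV"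
    and c: "quint_const z m' n' = c * quint_const z m n" and "c \<noteq> 0"
    and step: "\<And>k. c * (quint_summand z k * quint_weight z m n k) - quint_summand z k * quint_weight z m' n' k
       = d * (quint_cert z m n (k + 1) - quint_cert z m n k)"
  shows "((\<lambda>k. quint_summand z k * quint_weight z m n k) has_sum (K * quint_const z m n)) UNIV"
proof -
  have "((\<lambda>k. quint_cert z m n (k + 1) - quint_cert z m n k) has_sum 0) UNIV"
    by (rule has_sum_telescope_int[of "{-m..n}"]) (simp_all add: quint_cert_support)
  then have "((\<lambda>k. d * (quint_cert z m n (k + 1) - quint_cert z m n k)) has_sum d * 0) UNIV"
    by (rule has_sum_cmult_right)
  from has_sum_add[OF this sum]
  have "((\<lambda>k. c * (quint_summand z k * quint_weight z m n k)) has_sum c * (K * quint_const z m n)) UNIV"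
    by (simp add: c mult_ac flip: step)
  then show ?thesis using \<open>c \<noteq> 0\<close> by (simp add: has_sum_cmult_right_iff)
qed

definition quint_prod :: "complex \<Rightarrow> complex" where
  "quint_prod z = qpoch_inf z q * qpoch_inf (q / z) q * qpoch_inf q q
     * (qpoch_inf (q * z\<^sup>2) (q\<^sup>2) * qpoch_inf (q / z\<^sup>2) (q\<^sup>2))"

text \<open>Each induction step goes from (n, n) to (n, n + 1) and on to (n + 1, n + 1). The
  hypothesis on \<open>z\<close> keeps the factors 1 + z q^n and 1 + q^m/z nonzero.\<close>

lemma quint_finite:
  assumes z: "z \<noteq> 0" and zq: "\<And>k. z * q powi k \<noteq> -1"
  shows "((\<lambda>k. quint_summand z k * quint_weight z (int n) (int n) k) has_sum
           (quint_prod z * quint_const z (int n) (int n))) UNIV"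
proof (induction n)
  case 0
  have "((\<lambda>k. quint_summand z k * quint_weight z 0 0 k) has_sum (\<Sum>k\<in>{0}. quint_summand z k * quint_weight z 0 0 k)) UNIV"
    by (rule has_sum_finite_support) (auto simp: quint_weight_support)
  also have "(\<Sum>k\<in>{0}. quint_summand z k * quint_weight z 0 0 k)
     = (1 - z) * (qpoch_inf q q)\<^sup>2 * qpoch_inf (z\<^sup>2 * q) q * qpoch_inf (q / z\<^sup>2) q"
    by (simp add: quint_summand_def quint_weight_def qrec_0 power2_eq_square field_simps)
  \<comment> \<open>Only k = 0 contributes here. Splitting by parity of the exponent and factoring
    the square leaves the products in \<open>z * q\<close> and \<open>q / z\<close> for
    \<open>quint_prod\<close>, while those in \<open>- (z * q)\<close> and \<open>- (q / z)\<close>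
    form \<open>quint_const z 0 0\<close>.\<close>
  also have "qpoch_inf (z\<^sup>2 * q) q = qpoch_inf (q * z\<^sup>2) (q\<^sup>2) * (qpoch_inf (z * q) q * qpoch_inf (- (z * q)) q)"
    using qpoch_inf_bisect[OF q1, of "z\<^sup>2 * q"] qpoch_inf_square[OF q1, of "z * q"]
    by (simp add: power2_eq_square mult_ac)
  also have "qpoch_inf (q / z\<^sup>2) q = qpoch_inf (q / z\<^sup>2) (q\<^sup>2) * (qpoch_inf (q / z) q * qpoch_inf (- (q / z)) q)"
    using qpoch_inf_bisect[OF q1, of "q / z\<^sup>2"] qpoch_inf_square[OF q1, of "q / z"]
    by (simp add: power2_eq_square)
  also have "(1 - z) * (qpoch_inf q q)\<^sup>2 *
      (qpoch_inf (q * z\<^sup>2) (q\<^sup>2) * (qpoch_inf (z * q) q * qpoch_inf (- (z * q)) q)) *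
      (qpoch_inf (q / z\<^sup>2) (q\<^sup>2) * (qpoch_inf (q / z) q * qpoch_inf (- (q / z)) q))
    = quint_prod z * quint_const z 0 0"
    unfolding quint_prod_def quint_const_def qpoch_inf_step[OF q1, of z]
    by (simp add: qrec_0 power2_eq_square field_simps)
  finally show ?case by simp
next
  case (Suc n)
  have nz1: "(1 - q powi (int n + int (Suc n))) * (1 + z * q powi int (Suc n)) \<noteq> 0"
    using powi_ne_1[of "int n + int (Suc n)"] zq[of "int (Suc n)"]
    by (metis add_eq_0_iff add_nonneg_pos less_irrefl mult_eq_0_iff of_nat_0_le_iff of_nat_0_less_iff right_minus_eq zero_less_Suc minus_equation_iff)
  have nz2: "(1 - q powi (int (Suc n) + int (Suc n))) * (1 + inverse z * q powi int (Suc n)) \<noteq> 0"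
  proof -
    have "1 + inverse z * q powi int (Suc n) \<noteq> 0"
    proof
      assume "1 + inverse z * q powi int (Suc n) = 0"
      then have "z + q powi int (Suc n) = 0" using z by (simp add: field_simps)
      then have "z = - (q powi int (Suc n))" by (simp add: eq_neg_iff_add_eq_0)
      then have "z * q powi (- int (Suc n)) = -1" using q0 by (simp add: power_int_minus del: power_int_of_nat of_nat_Suc)
      with zq show False by blast
    qed
    moreover have "q powi (int (Suc n) + int (Suc n)) \<noteq> 1" by (rule powi_ne_1) simp
    ultimately show ?thesis by simp
  qed
  have "((\<lambda>k. quint_summand z k * quint_weight z (int n) (int (Suc n)) k) has_sum
           (quint_prod z * quint_const z (int n) (int (Suc n)))) UNIV"
    by (rule quint_has_sum_step[of z "int n" "int (Suc n) - 1", OF _ quint_const_pred_n nz1 quint_step_n[OF z]])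
      (use Suc in simp)
  then show ?case
    by (intro quint_has_sum_step[of z "int (Suc n) - 1" "int (Suc n)", OF _ quint_const_pred_m nz2 quint_step_m[OF z]])
      simp
qed

lemma quint_summand_summable:
  assumes "z \<noteq> 0"
  shows "quint_summand z summable_on UNIV"
proof -
  have q3: "norm (q powi 3) < 1"
    using q1 by (simp add: norm_power power_less_one_iff)
  have "(\<lambda>k. (z ^ 3 * q) powi k * (q powi 3) powi tri k + - z * ((z ^ 3 * q ^ 2) powi k * (q powi 3) powi tri k)) summable_on UNIV"
    using assms q0 q3 by (intro summable_on_add summable_on_cmult_right tri_summable) auto
  moreover have "(z ^ 3 * q) powi k * (q powi 3) powi tri k + - z * ((z ^ 3 * q ^ 2) powi k * (q powi 3) powi tri k)
     = quint_summand z k" for k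
  proof -
    have z3: "(z ^ 3) powi k = z powi (3 * k)" using power_int_mult[of z 3 k] by simp
    have q2: "(q ^ 2) powi k = q powi k * q powi k" using power_int_mult_distrib[of q q k] by (simp add: power2_eq_square)
    have t: "q powi (3 * tri k + k) = (q powi 3) powi tri k * q powi k"
      unfolding power_int_mult[symmetric] by (rule power_int_add) (simp add: q0)
    show ?thesis
      unfolding quint_summand_def power_int_mult_distrib z3 q2 t by algebra
  qed
  ultimately show ?thesis by (simp only:)
qed

text \<open>Let m = n tend to infinity in the finite form: the weight tends to 1 for each fixed k
  and is bounded uniformly, so the series itself, up to a constant, dominates.\<close>

theorem quintuple_product:
  assumes z: "z \<noteq> 0" and zq: "\<And>k. z * q powi k \<noteq> -1"
  shows "(quint_summand z has_sum quint_prod z) UNIV"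
proof -
  obtain C where C: "C > 0" "\<And>k. norm (qrec k) \<le> C" using qrec_bounded by blast
  obtain D where D: "D > 0" "\<And>k. k \<ge> 0 \<Longrightarrow> norm (qpoch_inf (z\<^sup>2 * q powi k) q) \<le> D"
    using qpoch_inf_powi_bounded by metis
  obtain E where E: "E > 0" "\<And>k. k \<ge> 0 \<Longrightarrow> norm (qpoch_inf (inverse (z\<^sup>2) * q powi k) q) \<le> E"
    using qpoch_inf_powi_bounded by metis
  have bound: "norm (quint_summand z k * quint_weight z (int n) (int n) k) \<le> norm (quint_summand z k) * (C * C * D * E)" for n k
  \<comment> \<open>The bounds \<open>D\<close> and \<open>E\<close> hold for nonnegative exponents
    only. The exponents n + k + 1 and n - k + 1 are positive on the support of the weight, and off
    it the weight is 0.\<close>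
  proof (cases "k \<in> {- int n..int n}")
    case True
    then show ?thesis
      unfolding quint_weight_def norm_mult
      by (intro mult_left_mono mult_mono C D E) (use C(1) D(1) E(1) in auto)
  next
    case False
    then show ?thesis using C(1) D(1) E(1) by (simp add: quint_weight_support)
  qed
  have lim: "(\<lambda>n. quint_summand z k * quint_weight z (int n) (int n) k) \<longlonglongrightarrow> quint_summand z k" for k
  proof -
    have "(\<lambda>n. quint_summand z k * (qrec (int n + - k) * qrec (int n + k) * qpoch_inf (z\<^sup>2 * q powi (int n + (k + 1))) q
     * qpoch_inf (inverse (z\<^sup>2) * q powi (int n + (- k + 1))) q)) \<longlonglongrightarrow> quint_summand z k * (1 * 1 * 1 * 1)"
      by (intro tendsto_intros qrec_tendsto qpoch_inf_powi_tendsto)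
    then show ?thesis by (simp add: quint_weight_def algebra_simps)
  qed
  have h: "(\<lambda>k. norm (quint_summand z k) * (C * C * D * E)) summable_on UNIV"
    using quint_summand_summable[OF z]
    by (intro summable_on_cmult_left) (simp flip: summable_on_iff_abs_summable_on_complex)
  have "(\<lambda>n. quint_prod z * quint_const z (int n) (int n)) \<longlonglongrightarrow> infsum (quint_summand z) UNIV"
    by (rule has_sum_dominated(2)[OF quint_finite[OF z zq] lim bound h])
  moreover have "(\<lambda>n. quint_prod z * quint_const z (int n) (int n)) \<longlonglongrightarrow> quint_prod z * (1 * 1 * 1)"
  proof -
    have "(\<lambda>n. qrec (int (2 * n) + 0)) \<longlonglongrightarrow> 1"
      using LIMSEQ_subseq_LIMSEQ[OF qrec_tendsto[of 0], of "\<lambda>n. 2 * n"]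
      by (simp add: strict_mono_def o_def)
    then show ?thesis
      unfolding quint_const_def
      by (intro tendsto_intros qpoch_inf_powi_tendsto) simp
  qed
  ultimately have "infsum (quint_summand z) UNIV = quint_prod z"
    using LIMSEQ_unique by fastforce
  then show ?thesis
    using has_sum_infsum[OF quint_summand_summable[OF z]] by simp
qed

subsection \<open>Bailey pairs\<close>

lemma powi_split: "k = a + b \<Longrightarrow> q powi k = q powi a * q powi b"
  using q0 by (simp add: power_int_add)

text \<open>\<open>\<Sum>j. (-1)^j q^(j(3j+1)/2) [N, \<lfloor>(N - 3j)/2\<rfloor>]_q = 1\<close>, split by the parity of \<open>j\<close>, for \<open>N = 2n\<close> and
  \<open>N = 2n + 1\<close> respectively; the passage from \<open>N\<close> to \<open>N + 1\<close> is Pascal's rule.\<close>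

definition even_term :: "int \<Rightarrow> int \<Rightarrow> complex" where
  "even_term n i = q powi (12 * tri i + 7 * i) * (qrec (n - 3 * i) * qrec (n + 3 * i))
     - q powi (12 * tri i + 13 * i + 2) * (qrec (n - 3 * i - 2) * qrec (n + 3 * i + 2))"

definition odd_term :: "int \<Rightarrow> int \<Rightarrow> complex" where
  "odd_term n i = q powi (12 * tri i + 7 * i) * (qrec (n - 3 * i) * qrec (n + 1 + 3 * i))
     - q powi (12 * tri i + 13 * i + 2) * (qrec (n - 3 * i - 1) * qrec (n + 2 + 3 * i))"

text \<open>Pascal's rule, applied to each of the two products of \<open>odd_term\<close>, leaves
  the same remainder q^(12 \<open>tri i\<close> + 10i + n + 1)
  \<open>qrec (n - 3 * i - 1) * qrec (n + 1 + 3 * i)\<close>, which cancels inside the term. Hence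
  this half step needs no certificate.\<close>

lemma even_eq_odd_term: "even_term n i = (1 - q powi (2 * n + 1)) * odd_term n i"
proof -
  define t N W where "t = q powi (3 * i)" and "N = q powi n" and "W = q powi (12 * tri i + 7 * i)"
  \<comment> \<open>These have the largest arguments that occur on each side, so
    \<open>qrec_step\<close> writes every other \<open>qrec\<close> as a multiple of one of them
    without division.\<close>
  define a b where "a = qrec (n - 3 * i)" and "b = qrec (n + 3 * i + 2)"
  have t: "t \<noteq> 0" using q0 by (simp add: t_def)
  have r1: "qrec (n + 1 + 3 * i) = (1 - q\<^sup>2 * N * t) * b"
    using qrec_step[of "n + 3 * i + 2"] q0
    by (simp add: b_def t_def N_def power_int_add power_int_diff algebra_simps)
  have "qrec (n + 3 * i) = (1 - q * N * t) * qrec (n + 1 + 3 * i)"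
    using qrec_step[of "n + 3 * i + 1"] q0
    by (simp add: t_def N_def power_int_add power_int_diff algebra_simps)
  note r2 = this[unfolded r1]
  have s1: "qrec (n - 3 * i - 1) = (1 - N / t) * a"
    using qrec_step[of "n - 3 * i"] q0
    by (simp add: a_def t_def N_def power_int_add power_int_diff algebra_simps)
  have "qrec (n - 3 * i - 2) = (1 - N / (q * t)) * qrec (n - 3 * i - 1)"
    using qrec_step[of "n - 3 * i - 1"] q0
    by (simp add: t_def N_def power_int_add power_int_diff algebra_simps)
  note s2 = this[unfolded s1]
  have b: "qrec (n + 2 + 3 * i) = b" by (simp add: b_def algebra_simps)
  note r = r1 r2 s1 s2 b
  have i6: "q powi (6 * i) = t\<^sup>2"
    unfolding t_def power2_eq_square by (rule powi_split) simp
  have w: "q powi (12 * tri i + 13 * i + 2) = W * (t\<^sup>2 * q\<^sup>2)"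
  proof -
    have "q powi (12 * tri i + 13 * i + 2) = W * q powi (6 * i + 2)"
      unfolding W_def by (rule powi_split) (simp add: tri_add)
    also have "q powi (6 * i + 2) = t\<^sup>2 * q powi 2"
      unfolding i6[symmetric] by (rule powi_split) (simp add: tri_add)
    finally show ?thesis by (simp add: power2_eq_square power3_eq_cube mult_ac)
  qed
  have nn: "q powi (2 * n) = N\<^sup>2"
    unfolding N_def power2_eq_square by (rule powi_split) simp
  have n2: "q powi (2 * n + 1) = N\<^sup>2 * q"
    unfolding nn[symmetric] by (subst powi_split[of _ "2 * n" "1"]) simp_all
  have "(1 - q * N * t) * (1 - q\<^sup>2 * N * t) - t\<^sup>2 * q\<^sup>2 * ((1 - N / (q * t)) * (1 - N / t))
     = (1 - N\<^sup>2 * q) * ((1 - q\<^sup>2 * N * t) - t\<^sup>2 * q\<^sup>2 * (1 - N / t))"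
    using t q0 by (simp add: field_simps) algebra
  from arg_cong[OF this, of "\<lambda>x. x * (W * a * b)"] show ?thesis
    unfolding even_term_def odd_term_def r w n2 a_def[symmetric] b_def[symmetric] W_def[symmetric]
    by (simp only: algebra_simps)
qed

text \<open>The remainder of Pascal's rule. With u = q^(n+1-3i) and v = q^(n+1+3i), writing 1 - uv =
  (1 - u) + u(1 - v) in the first product of \<open>even_term (n + 1) i\<close> produces the first
  product of \<open>odd_term n i\<close> and exactly this expression. The second product, split as
  (1 - v) + v(1 - u) with its own u and v, leaves the same expression at i + 1.\<close>

definition even_cert :: "int \<Rightarrow> int \<Rightarrow> complex" where
  "even_cert n i = q powi (12 * tri i + 4 * i + n + 1) * (qrec (n + 1 - 3 * i) * qrec (n + 3 * i))"

lemma even_term_step: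
  "(1 - q powi (2 * n + 2)) * even_term (n + 1) i - odd_term n i = - (even_cert n (i + 1) - even_cert n i)"
proof -
  define t N W where "t = q powi (3 * i)" and "N = q powi n" and "W = q powi (12 * tri i + 7 * i)"
  define a b where "a = qrec (n + 1 - 3 * i)" and "b = qrec (n + 3 * i + 3)"
  define y1 y2 y3 where "y1 = q * N / t" and "y2 = N / t" and "y3 = N / (q * t)"
  have t: "t \<noteq> 0" using q0 by (simp add: t_def)
  have r1: "qrec (n + 2 + 3 * i) = (1 - q ^ 3 * N * t) * b"
    using qrec_step[of "n + 3 * i + 3"] q0
    by (simp add: b_def t_def N_def power_int_add power_int_diff algebra_simps)
  have "qrec (n + 1 + 3 * i) = (1 - q\<^sup>2 * N * t) * qrec (n + 2 + 3 * i)"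
    using qrec_step[of "n + 3 * i + 2"] q0
    by (simp add: t_def N_def power_int_add power_int_diff algebra_simps)
  note r2 = this[unfolded r1]
  have "qrec (n + 3 * i) = (1 - q * N * t) * qrec (n + 1 + 3 * i)"
    using qrec_step[of "n + 3 * i + 1"] q0
    by (simp add: t_def N_def power_int_add power_int_diff algebra_simps)
  note r3 = this[unfolded r2]
  have s1: "qrec (n - 3 * i) = (1 - y1) * a"
    using qrec_step[of "n + 1 - 3 * i"] q0
    by (simp add: a_def y1_def t_def N_def power_int_add power_int_diff algebra_simps)
  have "qrec (n - 3 * i - 1) = (1 - y2) * qrec (n - 3 * i)"
    using qrec_step[of "n - 3 * i"] q0
    by (simp add: y2_def y3_def t_def N_def power_int_add power_int_diff algebra_simps)
  note s2 = this[unfolded s1]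
  have "qrec (n - 3 * i - 2) = (1 - y3) * qrec (n - 3 * i - 1)"
    using qrec_step[of "n - 3 * i - 1"] q0
    by (simp add: y2_def y3_def t_def N_def power_int_add power_int_diff algebra_simps)
  note s3 = this[unfolded s2]
  have e: "n + 1 - 3 * i - 2 = n - 3 * i - 1" "n + 1 + 3 * i + 2 = n + 3 * i + 3"
    "n + 1 - 3 * (i + 1) = n - 3 * i - 2" "n + 3 * (i + 1) = n + 3 * i + 3" by simp_all
  have i6: "q powi (6 * i) = t\<^sup>2"
    unfolding t_def power2_eq_square by (rule powi_split) simp
  have w: "q powi (12 * tri i + 13 * i + 2) = W * (t\<^sup>2 * q\<^sup>2)"
  proof -
    have "q powi (12 * tri i + 13 * i + 2) = W * q powi (6 * i + 2)"
      unfolding W_def by (rule powi_split) (simp add: tri_add)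
    also have "q powi (6 * i + 2) = t\<^sup>2 * q powi 2"
      unfolding i6[symmetric] by (rule powi_split) (simp add: tri_add)
    finally show ?thesis by (simp add: power2_eq_square power3_eq_cube mult_ac)
  qed
  have w1: "q powi (12 * tri i + 4 * i + n + 1) = W * (y1)"
  proof -
    have "q powi (12 * tri i + 4 * i + n + 1) = W * q powi (n - 3 * i + 1)"
      unfolding W_def by (rule powi_split) (simp add: tri_add)
    also have "q powi (n - 3 * i + 1) = q powi (n - 3 * i) * q powi 1"
      by (rule powi_split) (simp add: tri_add)
    finally show ?thesis by (simp add: y1_def t_def N_def power_int_diff q0 mult_ac)
  qed
  have i9: "q powi (9 * i) = t ^ 3"
  proof -
    have "q powi (9 * i) = q powi (6 * i) * t" unfolding t_def by (rule powi_split) simp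
    then show ?thesis by (simp add: i6 power3_eq_cube power2_eq_square)
  qed
  have w2: "q powi (12 * tri (i + 1) + 4 * (i + 1) + n + 1) = W * (q ^ 5 * N * t ^ 3)"
  proof -
    have "q powi (12 * tri (i + 1) + 4 * (i + 1) + n + 1) = W * q powi (9 * i + (n + 5))"
      unfolding W_def by (rule powi_split) (simp add: tri_add)
    also have "q powi (9 * i + (n + 5)) = t ^ 3 * q powi (n + 5)"
      unfolding i9[symmetric] by (rule powi_split) (simp add: tri_add)
    also have "q powi (n + 5) = N * q powi 5"
      unfolding N_def by (rule powi_split) (simp add: tri_add)
    finally show ?thesis by (simp add: mult_ac)
  qed
  have nn: "q powi (2 * n) = N\<^sup>2"
    unfolding N_def power2_eq_square by (rule powi_split) simp
  have n2: "q powi (2 * n + 2) = N\<^sup>2 * q\<^sup>2"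
    unfolding nn[symmetric] by (subst powi_split[of _ "2 * n" "2"]) simp_all
  have "(1 - N\<^sup>2 * q\<^sup>2) * ((1 - q\<^sup>2 * N * t) * (1 - q ^ 3 * N * t) - t\<^sup>2 * q\<^sup>2 * ((1 - y2) * (1 - y1)))
     - ((1 - y1) * ((1 - q\<^sup>2 * N * t) * (1 - q ^ 3 * N * t)) - t\<^sup>2 * q\<^sup>2 * ((1 - y2) * (1 - y1) * (1 - q ^ 3 * N * t)))
     = - (q ^ 5 * N * t ^ 3 * ((1 - y3) * (1 - y2) * (1 - y1))
        - y1 * ((1 - q * N * t) * (1 - q\<^sup>2 * N * t) * (1 - q ^ 3 * N * t)))"
    using t q0 unfolding y1_def y2_def y3_def by (simp add: field_simps) algebra
  from arg_cong[OF this, of "\<lambda>x. x * (W * a * b)"] show ?thesis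
    unfolding even_term_def odd_term_def even_cert_def e r1 r2 r3 s1 s2 s3 w w1 w2 n2 a_def[symmetric] b_def[symmetric] W_def[symmetric]
    by algebra
qed

lemma odd_sum_of_even_sum:
  assumes "n \<ge> 0" "(even_term n has_sum (qrec 0 * qrec (2 * n))) UNIV"
  shows "(odd_term n has_sum (qrec 0 * qrec (2 * n + 1))) UNIV"
proof (rule has_sum_cancel)
  have "even_term n = (\<lambda>i. (1 - q powi (2 * n + 1)) * odd_term n i)"
    by (rule ext) (rule even_eq_odd_term)
  moreover have "qrec 0 * qrec (2 * n) = (1 - q powi (2 * n + 1)) * (qrec 0 * qrec (2 * n + 1))"
    using qrec_step[of "2 * n + 1"] by simp
  ultimately show "((\<lambda>i. (1 - q powi (2 * n + 1)) * odd_term n i) has_sum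
     ((1 - q powi (2 * n + 1)) * (qrec 0 * qrec (2 * n + 1)))) UNIV"
    using assms(2) by (simp only:)
  show "1 - q powi (2 * n + 1) \<noteq> 0"
    using assms(1) powi_ne_1[of "2 * n + 1"] by simp
qed

text \<open>One step in n is two steps in the top index 2n of the q-binomials: term by term to 2n +
  1, then with \<open>even_cert\<close> to 2n + 2.\<close>

lemma even_sum: "(even_term (int n) has_sum (qrec 0 * qrec (2 * int n))) UNIV"
proof (induction n)
  case 0
  have z: "even_term 0 i = 0" if "i \<notin> {0}" for i
    using that by (cases "i < 0") (simp_all add: even_term_def qrec_neg)
  have "even_term 0 0 = qrec 0 * qrec 0"
    by (simp add: even_term_def qrec_neg)
  with has_sum_finite_support[of "{0}" "even_term 0", OF _ z] show ?case by simp
next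
  case (Suc n)
  have "((\<lambda>i. even_cert (int n) (i + 1) - even_cert (int n) i) has_sum 0) UNIV"
    by (rule has_sum_telescope_int[of "{- int n - 1..int n + 1}"]) (auto simp: even_cert_def qrec_neg)
  note A = has_sum_add[OF has_sum_uminusI[OF this] odd_sum_of_even_sum[OF of_nat_0_le_iff Suc]]
  have eq: "(\<lambda>i. - (even_cert (int n) (i + 1) - even_cert (int n) i) + odd_term (int n) i)
      = (\<lambda>i. (1 - q powi (2 * int n + 2)) * even_term (int n + 1) i)"
    by (rule ext) (simp only: even_term_step[symmetric], simp)
  have "((\<lambda>i. (1 - q powi (2 * int n + 2)) * even_term (int n + 1) i) has_sum (qrec 0 * qrec (2 * int n + 1))) UNIV"
    using A unfolding eq by simp
  also have "qrec 0 * qrec (2 * int n + 1) = (1 - q powi (2 * int n + 2)) * (qrec 0 * qrec (2 * int n + 2))"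
    using qrec_step[of "2 * int n + 2"] by (simp add: add.commute)
  finally have "(even_term (int n + 1) has_sum (qrec 0 * qrec (2 * int n + 2))) UNIV"
    by (rule has_sum_cancel) (use powi_ne_1[of "2 * int n + 2"] in simp)
  then show ?case by (simp add: add.commute)
qed

text \<open>Up to a constant this is the Bailey kernel 1/((q;q)_(n-j) (aq;q)_(n+j)) for a = q. It is
  symmetric under j to -1 - j, so a sum over j >= 0 may be rearranged as one over selected integers
  of either sign.\<close>

definition pair_weight :: "int \<Rightarrow> int \<Rightarrow> complex" where
  "pair_weight n j = qrec (n - j) * qrec (n + 1 + j)"

lemma bailey_pair_S0:
  "((\<lambda>i. q powi (12 * tri i + 7 * i) * pair_weight (int n) (3 * i)
       + - (q powi (12 * tri i + 13 * i + 2)) * pair_weight (int n) (3 * i + 1))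
     has_sum (qrec 0 * qrec (2 * int n + 1))) UNIV"
  using odd_sum_of_even_sum[OF _ even_sum[of n]]
  by (simp add: odd_term_def[abs_def] pair_weight_def algebra_simps)

text \<open>\<open>even_term\<close> has arguments adding up to 2n, the kernel 2n + 1. The
  telescoping term trades the second product for its copy at the preceding index; then both products
  are multiples of the kernel at -3i, and the unwanted parts cancel because their exponents of q
  agree.\<close>

lemma bailey_pair_T0:
  "((\<lambda>i. q powi (12 * tri i + 7 * i) * pair_weight (int n) (- 3 * i)
       + - (q powi (12 * tri i + i + 1)) * pair_weight (int n) (- 3 * i))
     has_sum (qrec 0 * qrec (2 * int n))) UNIV"
proof -
  define N where "N = int n"
  define H where "H i = q powi (12 * tri i + i + 1) * (qrec (N - 3 * i + 1) * qrec (N + 3 * i - 1))" for i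
  have "((\<lambda>i. H (i + 1) - H i) has_sum 0) UNIV"
    by (rule has_sum_telescope_int[of "{- N - 1..N + 1}"]) (auto simp: H_def qrec_neg N_def)
  from has_sum_add[OF this even_sum[of n]]
  have "((\<lambda>i. H (i + 1) - H i + even_term N i) has_sum (qrec 0 * qrec (2 * N))) UNIV"
    by (simp add: N_def)
  moreover have "H (i + 1) - H i + even_term N i = q powi (12 * tri i + 7 * i) * pair_weight N (- 3 * i)
       + - (q powi (12 * tri i + i + 1)) * pair_weight N (- 3 * i)" for i
  proof -
    have "12 * tri (i + 1) + (i + 1) + 1 = 12 * tri i + 13 * i + 2" by (simp add: tri_add)
    then have H1: "H (i + 1) = q powi (12 * tri i + 13 * i + 2) * (qrec (N - 3 * i - 2) * qrec (N + 3 * i + 2))"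
      unfolding H_def by (simp add: algebra_simps)
    define a b where "a = qrec (N - 3 * i + 1)" and "b = qrec (N + 3 * i)"
    have r: "qrec (N - 3 * i) = (1 - q powi (N - 3 * i + 1)) * a" "qrec (N + 3 * i - 1) = (1 - q powi (N + 3 * i)) * b"
      using qrec_step[of "N - 3 * i + 1"] qrec_step[of "N + 3 * i"] by (simp_all add: a_def b_def)
    have "(12 * tri i + 7 * i) + (N - 3 * i + 1) = (12 * tri i + i + 1) + (N + 3 * i)" by simp
    then have "q powi (12 * tri i + 7 * i) * q powi (N - 3 * i + 1) = q powi (12 * tri i + i + 1) * q powi (N + 3 * i)"
      using q0 by (metis power_int_add)
    then have "q powi (12 * tri i + 7 * i) * ((1 - q powi (N - 3 * i + 1)) * a * b) - q powi (12 * tri i + i + 1) * (a * ((1 - q powi (N + 3 * i)) * b))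
       = q powi (12 * tri i + 7 * i) * (b * a) + - (q powi (12 * tri i + i + 1)) * (b * a)"
      by algebra
    moreover have "pair_weight N (- 3 * i) = b * a"
      by (simp add: pair_weight_def a_def b_def algebra_simps)
    ultimately show ?thesis
      unfolding H1 unfolding H_def even_term_def r by (simp add: a_def b_def)
  qed
  ultimately show ?thesis by (simp add: N_def)
qed

lemma bailey_pair_S1:
  "((\<lambda>i. q powi (12 * tri i + 10 * i) * pair_weight (int n) (3 * i)
       + - (q powi (12 * tri i + 14 * i + 2)) * pair_weight (int n) (3 * i + 1))
     has_sum (qrec 0 * (q ^ n * qrec (2 * int n + 1)))) UNIV"
proof -
  define M where "M = int n"
  define N where "N = q powi M"
  \<comment> \<open>By Pascal's rule, (1 - q^(2M+1)) times the second kernel term is exactly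
    \<open>H (- 1 - i)\<close>, and times the first it is the first summand of \<open>H i\<close>
    plus \<open>N\<close> times the first product of \<open>even_term\<close>. The second summand of
    \<open>H i\<close> compensates for the second product of
    \<open>N * even_term M i\<close>.\<close>
  define H where "H i = (q powi (12 * tri i + 10 * i) * (qrec (M - 3 * i - 1) * qrec (M + 3 * i + 1))
     + N * (q powi (12 * tri i + 13 * i + 2) * (qrec (M - 3 * i - 2) * qrec (M + 3 * i + 2))))" for i
  have nz: "q powi (2 * M + 1) \<noteq> 1" by (rule powi_ne_1) (simp add: M_def)
  have "((\<lambda>i. H i - H (- 1 - i)) has_sum 0) UNIV"
    by (rule has_sum_antisymmetrize[of "{- M - 1..M + 1}"]) (auto simp: H_def qrec_neg M_def)
  from has_sum_add[OF this has_sum_cmult_right[OF even_sum[of n], of N]]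
  have "((\<lambda>i. H i - H (- 1 - i) + N * even_term M i) has_sum (N * (qrec 0 * qrec (2 * M)))) UNIV"
    by (simp add: M_def)
  moreover have "H i - H (- 1 - i) + N * even_term M i = (1 - q powi (2 * M + 1)) *
      (q powi (12 * tri i + 10 * i) * pair_weight M (3 * i)
       + - (q powi (12 * tri i + 14 * i + 2)) * pair_weight M (3 * i + 1))" for i
  proof -
    define t W s where "t = q powi (3 * i)" and "W = q powi (12 * tri i + 7 * i)" and "s = q powi i"
    define a b where "a = qrec (M - 3 * i)" and "b = qrec (M + 3 * i + 2)"
    have t: "t \<noteq> 0" "s \<noteq> 0" using q0 by (simp_all add: t_def s_def)
    have ts: "t = s ^ 3" by (simp add: t_def s_def power_int_mult power3_eq_cube mult.commute[of 3])
    have r1: "qrec (M + 3 * i + 1) = (1 - q\<^sup>2 * N * t) * b"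
      using qrec_step[of "M + 3 * i + 2"] q0
      by (simp add: b_def t_def N_def power_int_add power_int_diff algebra_simps)
    have "qrec (M + 3 * i) = (1 - q * N * t) * qrec (M + 3 * i + 1)"
      using qrec_step[of "M + 3 * i + 1"] q0
      by (simp add: t_def N_def power_int_add power_int_diff algebra_simps)
    note r2 = this[unfolded r1]
    have s1: "qrec (M - 3 * i - 1) = (1 - N / t) * a"
      using qrec_step[of "M - 3 * i"] q0
      by (simp add: a_def t_def N_def power_int_add power_int_diff algebra_simps)
    have "qrec (M - 3 * i - 2) = (1 - N / (q * t)) * qrec (M - 3 * i - 1)"
      using qrec_step[of "M - 3 * i - 1"] q0
      by (simp add: t_def N_def power_int_add power_int_diff algebra_simps)
    note s2 = this[unfolded s1]
    note r = r1 r2 s1 s2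
    have tr: "tri (- 1 - i) = tri i + 2 * i + 1"
    proof -
      have "- 1 - i = - (i + 1)" by simp
      then show ?thesis by (simp only: tri_uminus tri_add) simp
    qed
    have H': "H (- 1 - i) = q powi (12 * tri i + 14 * i + 2) * (qrec (M - 3 * i - 2) * qrec (M + 3 * i + 2))
     + N * (q powi (12 * tri i + 11 * i + 1) * (qrec (M - 3 * i - 1) * qrec (M + 3 * i + 1)))"
      unfolding H_def tr by (simp add: algebra_simps)
    have p: "pair_weight M (3 * i) = qrec (M - 3 * i) * qrec (M + 3 * i + 1)"
      "pair_weight M (3 * i + 1) = qrec (M - 3 * i - 1) * qrec (M + 3 * i + 2)"
      by (simp_all add: pair_weight_def algebra_simps)
    have i6: "q powi (6 * i) = t\<^sup>2"
      unfolding t_def power2_eq_square by (rule powi_split) simp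
    have i4: "q powi (4 * i) = t * s"
      unfolding t_def s_def by (rule powi_split) simp
    have i7: "q powi (7 * i) = t\<^sup>2 * s"
      unfolding i6[symmetric] s_def by (rule powi_split) simp
    have w1: "q powi (12 * tri i + 13 * i + 2) = W * (t\<^sup>2 * q\<^sup>2)"
    proof -
      have "q powi (12 * tri i + 13 * i + 2) = W * q powi (6 * i + 2)"
        unfolding W_def by (rule powi_split) (simp add: tri_add)
      also have "q powi (6 * i + 2) = t\<^sup>2 * q powi 2"
        unfolding i6[symmetric] by (rule powi_split) (simp add: tri_add)
      finally show ?thesis by (simp add: power2_eq_square power3_eq_cube mult_ac)
    qed
    have w2: "q powi (12 * tri i + 10 * i) = W * t"
      unfolding W_def t_def by (rule powi_split) simp
    have w3: "q powi (12 * tri i + 14 * i + 2) = W * (t\<^sup>2 * s * q\<^sup>2)"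
    proof -
      have "q powi (12 * tri i + 14 * i + 2) = W * q powi (7 * i + 2)"
        unfolding W_def by (rule powi_split) (simp add: tri_add)
      also have "q powi (7 * i + 2) = (t\<^sup>2 * s) * q powi 2"
        unfolding i7[symmetric] by (rule powi_split) (simp add: tri_add)
      finally show ?thesis by (simp add: power2_eq_square power3_eq_cube mult_ac)
    qed
    have w4: "q powi (12 * tri i + 11 * i + 1) = W * (t * s * q)"
    proof -
      have "q powi (12 * tri i + 11 * i + 1) = W * q powi (4 * i + 1)"
        unfolding W_def by (rule powi_split) (simp add: tri_add)
      also have "q powi (4 * i + 1) = (t * s) * q powi 1"
        unfolding i4[symmetric] by (rule powi_split) (simp add: tri_add)
      finally show ?thesis by (simp add: power2_eq_square power3_eq_cube mult_ac)
    qed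
    note w = w1 w2 w3 w4
    have nn: "q powi (2 * M) = N\<^sup>2"
      unfolding N_def power2_eq_square by (rule powi_split) simp
    have n2: "q powi (2 * M + 1) = N\<^sup>2 * q"
      unfolding nn[symmetric] by (subst powi_split[of _ "2 * M" "1"]) simp_all
    have "t * ((1 - N / t) * (1 - q\<^sup>2 * N * t)) + N * (t\<^sup>2 * q\<^sup>2 * ((1 - N / (q * t)) * (1 - N / t)))
       - (t\<^sup>2 * s * q\<^sup>2 * ((1 - N / (q * t)) * (1 - N / t)) + N * (t * s * q * ((1 - N / t) * (1 - q\<^sup>2 * N * t))))
       + N * ((1 - q * N * t) * (1 - q\<^sup>2 * N * t) - t\<^sup>2 * q\<^sup>2 * ((1 - N / (q * t)) * (1 - N / t)))
      = (1 - N\<^sup>2 * q) * (t * (1 - q\<^sup>2 * N * t) + - (t\<^sup>2 * s * q\<^sup>2 * (1 - N / t)))"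
      using t(1) q0 by (simp add: field_simps) algebra
    from arg_cong[OF this, of "\<lambda>x. x * (W * a * b)"] show ?thesis
      unfolding H' unfolding H_def even_term_def p r w n2 a_def[symmetric] b_def[symmetric] W_def[symmetric]
      by (simp only: algebra_simps mult_minus_left mult_minus_right minus_add_distrib)
  qed
  moreover have "N * (qrec 0 * qrec (2 * M)) = (1 - q powi (2 * M + 1)) * (qrec 0 * (N * qrec (2 * M + 1)))"
    using qrec_step[of "2 * M + 1"] by simp
  ultimately have "((\<lambda>i. (1 - q powi (2 * M + 1)) * (q powi (12 * tri i + 10 * i) * pair_weight M (3 * i)
       + - (q powi (12 * tri i + 14 * i + 2)) * pair_weight M (3 * i + 1))) has_sum
      ((1 - q powi (2 * M + 1)) * (qrec 0 * (N * qrec (2 * M + 1))))) UNIV"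
    by (simp only:)
  from has_sum_cancel[OF this] nz show ?thesis by (simp add: M_def N_def)
qed

subsection \<open>The limiting case of the Bailey lemma\<close>

text \<open>With \<open>j\<close> and \<open>L\<close> fixed, the sum over \<open>n\<close> in \<open>bailey_finite\<close> is a q-Chu-Vandermonde sum;
  \<open>G\<close> below is its WZ certificate in \<open>L\<close>. The step from \<open>L\<close> to \<open>L + 1\<close> degenerates at \<open>L + 1 = j\<close>, so
  the induction starts at \<open>L = j\<close>.\<close>

definition bailey_weight :: "nat \<Rightarrow> complex" where
  "bailey_weight n = q powi tri (int n + 1) * qpoch (- q) q n"

lemma bailey_weight_Suc: "bailey_weight (Suc n) = q powi (int n + 1) * (1 + q powi (int n + 1)) * bailey_weight n"
proof -
  have "q powi (tri (int (Suc n) + 1)) = q powi tri (int n + 1) * q powi (int n + 1)"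
    by (rule powi_split) (simp add: tri_add)
  moreover have "1 - - q * q ^ n = 1 + q powi (int n + 1)"
    using q0 by (simp add: power_int_add)
  ultimately show ?thesis
    by (simp only: bailey_weight_def qpoch_Suc mult_ac)
qed

lemma pair_weight_reflect: "pair_weight n (- 1 - j) = pair_weight n j"
proof -
  have "n - (- 1 - j) = n + 1 + j" "n + 1 + (- 1 - j) = n - j" by simp_all
  then show ?thesis by (simp only: pair_weight_def mult.commute)
qed

lemma bailey_finite_diag:
  assumes "L \<le> J"
  shows "(\<Sum>n\<le>L. bailey_weight n * (qrec (int L - int n) * pair_weight (int n) (int J)))
       = qrec 0 * qpoch (- q) q L * q powi tri (int J + 1) * pair_weight (int L) (int J)"
proof -
  have z: "pair_weight (int n) (int J) = 0" if "n < J" for n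
    using that by (simp add: pair_weight_def qrec_neg)
  show ?thesis
  proof (cases "L < J")
    case True
    then show ?thesis using z by simp
  next
    case False
    with assms have "L = J" by simp
    have "(\<Sum>n\<le>L. bailey_weight n * (qrec (int L - int n) * pair_weight (int n) (int J)))
      = (\<Sum>n\<in>{L}. bailey_weight n * (qrec (int L - int n) * pair_weight (int n) (int J)))"
      by (rule sum.mono_neutral_right) (use z \<open>L = J\<close> in auto)
    then show ?thesis by (simp add: \<open>L = J\<close> bailey_weight_def)
  qed
qed

lemma bailey_finite_nonneg:
  "(\<Sum>n\<le>L. bailey_weight n * (qrec (int L - int n) * pair_weight (int n) (int J)))
       = qrec 0 * qpoch (- q) q L * q powi tri (int J + 1) * pair_weight (int L) (int J)"
proof (induction L)
  case 0
  show ?case by (rule bailey_finite_diag) simp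
next
  case (Suc L)
  show ?case
  proof (cases "Suc L \<le> J")
    case True
    then show ?thesis by (rule bailey_finite_diag)
  next
    case False
    define N Q where "N = q powi (int L + 1)" and "Q = q powi int J"
    have Q: "Q \<noteq> 0" using q0 by (simp add: Q_def)
    define G where "G n = q powi (int L + 1 - int n) * bailey_weight n * qrec (int L + 1 - int n)
       * (qrec (int n - int J - 1) * qrec (int n + int J))" for n
    define f where "f n = bailey_weight n * (qrec (int (Suc L) - int n) * pair_weight (int n) (int J))" for n
    define g where "g n = bailey_weight n * (qrec (int L - int n) * pair_weight (int n) (int J))" for n
    have step: "(1 - N / Q) * (1 - N * Q * q) * f n - (1 + N) * g n = G n - G (Suc n)" for n
    proof -
      define x where "x = q powi int n"
      have x: "x \<noteq> 0" using q0 by (simp add: x_def)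
      define a b c W where "a = qrec (int L + 1 - int n)" and "b = qrec (int n - int J)"
        and "c = qrec (int n + 1 + int J)" and "W = bailey_weight n"
      have r1: "qrec (int L - int n) = (1 - N / x) * a"
        using qrec_step[of "int L + 1 - int n"] q0
        by (simp add: a_def N_def x_def power_int_add power_int_diff)
      have r2: "qrec (int n - int J - 1) = (1 - x / Q) * b"
        using qrec_step[of "int n - int J"] q0
        by (simp add: b_def Q_def x_def power_int_diff)
      have r3: "qrec (int n + int J) = (1 - x * Q * q) * c"
        using qrec_step[of "int n + 1 + int J"] q0
        by (simp add: c_def Q_def x_def power_int_add mult_ac)
      have e: "int (Suc L) - int n = int L + 1 - int n" "int L + 1 - int (Suc n) = int L - int n"
        "int (Suc n) - int J - 1 = int n - int J" "int (Suc n) + int J = int n + 1 + int J" by simp_all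
      have w: "q powi (int L + 1 - int n) = N / x" "q powi (int L - int n) = N / (q * x)" "q powi (int n + 1) = q * x"
        using q0 by (simp_all add: N_def x_def power_int_add power_int_diff)
      have "(1 - N / Q) * (1 - N * Q * q) - (1 + N) * (1 - N / x)
          = N / x * ((1 - x / Q) * (1 - x * Q * q)) - N / (q * x) * (q * x * (1 + q * x)) * (1 - N / x)"
        using x Q q0 by (simp add: field_simps)
      from arg_cong[OF this, of "\<lambda>t. t * (W * a * b * c)"] show ?thesis
        unfolding f_def g_def G_def e bailey_weight_Suc pair_weight_def r1 r2 r3 w
          a_def[symmetric] b_def[symmetric] c_def[symmetric] W_def[symmetric]
        by (simp only: algebra_simps)
    qed
    \<comment> \<open>Both sums run to L + 1 so that \<open>step\<close> can be summed; the extra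
      \<open>g (Suc L)\<close> vanishes because it contains \<open>qrec (- 1)\<close>.\<close>
    have "(1 - N / Q) * (1 - N * Q * q) * (\<Sum>n\<le>Suc L. f n) - (1 + N) * (\<Sum>n\<le>Suc L. g n) = (\<Sum>n\<le>Suc L. G n - G (Suc n))"
      unfolding step[symmetric] sum_subtractf sum_distrib_left ..
    also have "\<dots> = G 0 - G (Suc (Suc L))"
      by (rule sum_telescope)
    \<comment> \<open>Both ends vanish through a negative argument of \<open>qrec\<close>: -J - 1 in
      \<open>G 0\<close>, and -1 in \<open>G (Suc (Suc L))\<close>.\<close>
    also have "\<dots> = 0" by (simp add: G_def qrec_neg)
    also have "(\<Sum>n\<le>Suc L. g n) = (\<Sum>n\<le>L. g n)"
      by (simp add: g_def qrec_neg)
    also have "\<dots> = qrec 0 * qpoch (- q) q L * q powi tri (int J + 1) * pair_weight (int L) (int J)"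
      using Suc by (simp add: g_def)
    also have "pair_weight (int L) (int J) = (1 - N / Q) * (1 - N * Q * q) * pair_weight (int (Suc L)) (int J)"
    proof -
      have "qrec (int L - int J) = (1 - N / Q) * qrec (int (Suc L) - int J)"
        using qrec_step[of "int L + 1 - int J"] q0 by (simp add: N_def Q_def power_int_add power_int_diff add.commute)
      moreover have "qrec (int L + 1 + int J) = (1 - N * Q * q) * qrec (int (Suc L) + 1 + int J)"
        using qrec_step[of "int L + 2 + int J"] q0 by (simp add: N_def Q_def power_int_add power2_eq_square algebra_simps)
      ultimately show ?thesis by (simp only: pair_weight_def mult_ac)
    qed
    finally have eq: "(1 - N / Q) * (1 - N * Q * q) * (\<Sum>n\<le>Suc L. f n) =
       (1 - N / Q) * (1 - N * Q * q) * (qrec 0 * (qpoch (- q) q L * (1 + N)) * q powi tri (int J + 1) * pair_weight (int (Suc L)) (int J))"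
      by (simp only: right_minus_eq mult_ac)
    have "1 - N / Q \<noteq> 0"
      using powi_ne_1[of "int L + 1 - int J"] False q0 by (simp add: N_def Q_def power_int_diff)
    moreover have "1 - N * Q * q \<noteq> 0"
      using powi_ne_1[of "int L + 1 + int J + 1"] q0 by (simp add: N_def Q_def power_int_add power2_eq_square mult_ac)
    ultimately have nz: "(1 - N / Q) * (1 - N * Q * q) \<noteq> 0" by simp
    have "(\<Sum>n\<le>Suc L. f n) = qrec 0 * (qpoch (- q) q L * (1 + N)) * q powi tri (int J + 1) * pair_weight (int (Suc L)) (int J)"
      using eq unfolding mult_left_cancel[OF nz] .
    moreover have "qpoch (- q) q L * (1 + N) = qpoch (- q) q (Suc L)"
      using q0 by (simp add: qpoch_Suc N_def power_int_add mult_ac)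
    ultimately show ?thesis by (simp only: f_def)
  qed
qed

lemma bailey_finite:
  "(\<Sum>n\<le>L. bailey_weight n * (qrec (int L - int n) * pair_weight (int n) j))
       = qrec 0 * qpoch (- q) q L * q powi tri (j + 1) * pair_weight (int L) j"
proof (cases "j \<ge> 0")
  case True
  then show ?thesis using bailey_finite_nonneg[of L "nat j"] by simp
next
  case False
  have "tri (- 1 - j + 1) = tri (j + 1)"
    by (simp add: tri_uminus tri_add)
  with False show ?thesis
    using bailey_finite_nonneg[of L "nat (- 1 - j)"] by (simp add: pair_weight_reflect)
qed

lemma pair_weight_bounded: "\<exists>C>0. \<forall>n j. norm (pair_weight n j) \<le> C"
proof -
  obtain C where C: "C > 0" "\<And>k. norm (qrec k) \<le> C" using qrec_bounded by blast
  have "norm (pair_weight n j) \<le> C * C" for n j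
    unfolding pair_weight_def norm_mult using C by (intro mult_mono) (auto intro: less_imp_le)
  with C(1) show ?thesis by (intro exI[of _ "C * C"]) auto
qed

lemma pair_weight_tendsto: "(\<lambda>n. pair_weight (int n) j) \<longlonglongrightarrow> 1"
proof -
  have "(\<lambda>n. qrec (int n + - j) * qrec (int n + (1 + j))) \<longlonglongrightarrow> 1 * 1"
    by (intro tendsto_intros qrec_tendsto)
  then show ?thesis by (simp add: pair_weight_def add.assoc)
qed

lemma qpoch_bounded: "\<exists>C>0. \<forall>n. norm (qpoch a q n) \<le> C"
proof -
  have "Bseq (qpoch a q)"
    using qpoch_LIMSEQ[OF q1] by (rule convergent_imp_Bseq[OF convergentI])
  then show ?thesis by (auto simp: Bseq_def)
qed

lemma qpoch_powi_tri: "q powi tri (int n + 1) = q ^ (n * (n + 1) div 2)"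
  by (simp add: tri_nat)

lemma tri_power_summable: "summable (\<lambda>n. norm (q ^ (n * (n + 1) div 2)))"
proof (rule summable_comparison_test')
  show "summable (\<lambda>n. norm q ^ n)" using q1 by (intro summable_geometric) simp
  fix n :: nat assume "n \<ge> 0"
  have "2 * n \<le> n * (n + 1)" by (cases n) auto
  then have "n \<le> n * (n + 1) div 2" by linarith
  then show "norm (norm (q ^ (n * (n + 1) div 2))) \<le> norm q ^ n"
    using q1 by (simp add: norm_power power_decreasing del: mult_Suc_right)
qed

text \<open>The finite sum \<open>S L\<close> is evaluated in two ways. Inserting the pair and
  exchanging summations makes it a bilateral series over i through \<open>bailey_finite\<close>;
  read directly it is a truncated series over n. Dominated convergence applies to both. Two families
  (c, j) and (d, k) occur because every pair used here is a difference of two theta-like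
  sequences.\<close>

lemma bailey_limit:
  assumes fin: "\<And>n. ((\<lambda>i. c i * pair_weight (int n) (j i) + d i * pair_weight (int n) (k i))
      has_sum (qrec 0 * b n)) UNIV"
    and B: "\<And>n. norm (b n) \<le> B"
    and c: "(\<lambda>i. c i * q powi tri (j i + 1)) summable_on UNIV"
    and d: "(\<lambda>i. d i * q powi tri (k i + 1)) summable_on UNIV"
  shows "(\<lambda>n. bailey_weight n * b n) sums
     (qpoch_inf (- q) q * (infsum (\<lambda>i. c i * q powi tri (j i + 1)) UNIV + infsum (\<lambda>i. d i * q powi tri (k i + 1)) UNIV))"
proof -
  define S where "S L = (\<Sum>n\<le>L. bailey_weight n * qrec (int L - int n) * b n)" for L
  define t where "t L i = qpoch (- q) q L * (c i * q powi tri (j i + 1) * pair_weight (int L) (j i)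
        + d i * q powi tri (k i + 1) * pair_weight (int L) (k i))" for L i
  have t: "(t L has_sum S L) UNIV" for L
  proof -
    have "((\<lambda>i. \<Sum>n\<le>L. bailey_weight n * qrec (int L - int n) *
         (c i * pair_weight (int n) (j i) + d i * pair_weight (int n) (k i)))
       has_sum (\<Sum>n\<le>L. bailey_weight n * qrec (int L - int n) * (qrec 0 * b n))) UNIV"
      by (intro has_sum_sum_atMost has_sum_cmult_right fin)
    also have "(\<lambda>i. \<Sum>n\<le>L. bailey_weight n * qrec (int L - int n) *
         (c i * pair_weight (int n) (j i) + d i * pair_weight (int n) (k i))) = (\<lambda>i. qrec 0 * t L i)"
    proof
      fix i
      have "(\<Sum>n\<le>L. bailey_weight n * qrec (int L - int n) *
         (c i * pair_weight (int n) (j i) + d i * pair_weight (int n) (k i)))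
        = c i * (\<Sum>n\<le>L. bailey_weight n * (qrec (int L - int n) * pair_weight (int n) (j i)))
        + d i * (\<Sum>n\<le>L. bailey_weight n * (qrec (int L - int n) * pair_weight (int n) (k i)))"
        unfolding sum_distrib_left sum.distrib[symmetric] by (intro sum.cong refl) algebra
      also have "\<dots> = qrec 0 * t L i"
        unfolding bailey_finite t_def by algebra
      finally show "(\<Sum>n\<le>L. bailey_weight n * qrec (int L - int n) *
         (c i * pair_weight (int n) (j i) + d i * pair_weight (int n) (k i))) = qrec 0 * t L i" .
    qed
    also have "(\<Sum>n\<le>L. bailey_weight n * qrec (int L - int n) * (qrec 0 * b n)) = qrec 0 * S L"
      by (simp only: S_def sum_distrib_left mult_ac)
    finally show ?thesis by (rule has_sum_cancel) (simp add: qrec_nonzero)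
  qed
  obtain C where C: "C > 0" "\<And>n j. norm (pair_weight n j) \<le> C" using pair_weight_bounded by blast
  obtain D where D: "D > 0" "\<And>n. norm (qpoch (- q) q n) \<le> D" using qpoch_bounded by blast
  obtain E where E: "E > 0" "\<And>n. norm (qrec n) \<le> E" using qrec_bounded by blast
  have lim_right: "S \<longlonglongrightarrow> infsum (\<lambda>i. qpoch_inf (- q) q * (c i * q powi tri (j i + 1) + d i * q powi tri (k i + 1))) UNIV"
  proof (rule has_sum_dominated(2)[OF t])
    show "(\<lambda>L. t L i) \<longlonglongrightarrow> qpoch_inf (- q) q * (c i * q powi tri (j i + 1) + d i * q powi tri (k i + 1))" for i
    proof -
      have "(\<lambda>L. t L i) \<longlonglongrightarrow> qpoch_inf (- q) q * (c i * q powi tri (j i + 1) * 1 + d i * q powi tri (k i + 1) * 1)"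
        unfolding t_def by (intro tendsto_intros pair_weight_tendsto qpoch_LIMSEQ q1)
      then show ?thesis by simp
    qed
    show "norm (t L i) \<le> D * (norm (c i * q powi tri (j i + 1)) * C + norm (d i * q powi tri (k i + 1)) * C)" for L i
      unfolding t_def norm_mult[of "qpoch (- q) q L"]
      by (intro mult_mono D order_trans[OF norm_triangle_ineq] add_mono)
        (use C D in \<open>auto simp: norm_mult intro!: mult_left_mono\<close>)
    show "(\<lambda>i. D * (norm (c i * q powi tri (j i + 1)) * C + norm (d i * q powi tri (k i + 1)) * C)) summable_on UNIV"
      using c d unfolding summable_on_iff_abs_summable_on_complex
      by (intro summable_on_cmult_right summable_on_add summable_on_cmult_left)
  qed
  have h: "(\<lambda>n. norm (q ^ (n * (n + 1) div 2)) * (D * E * B)) summable_on UNIV"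
    using tri_power_summable by (intro summable_on_cmult_left) (simp add: summable_on_UNIV_nonneg_real_iff)
  \<comment> \<open>Extension by 0 beyond \<open>L\<close> gives all truncations the common index
    set required for dominated convergence.\<close>
  define s where "s L n = (if n \<le> L then bailey_weight n * qrec (int L - int n) * b n else 0)" for L n
  have s: "(s L has_sum S L) UNIV" for L
    using has_sum_finite_support[of "{..L}" "s L"] by (simp add: s_def S_def)
  have s_lim: "(\<lambda>L. s L n) \<longlonglongrightarrow> bailey_weight n * b n" for n
  proof -
    have "(\<lambda>L. bailey_weight n * qrec (int L + - int n) * b n) \<longlonglongrightarrow> bailey_weight n * 1 * b n"
      by (intro tendsto_intros qrec_tendsto)
    moreover have "eventually (\<lambda>L. bailey_weight n * qrec (int L + - int n) * b n = s L n) sequentially"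
      using eventually_ge_at_top[of n] by eventually_elim (simp add: s_def)
    ultimately show ?thesis by (simp add: filterlim_cong[OF refl refl])
  qed
  have "B \<ge> 0" using B[of 0] norm_ge_zero order_trans by blast
  have bw: "norm (bailey_weight n) \<le> norm (q ^ (n * (n + 1) div 2)) * D" for n
    unfolding bailey_weight_def qpoch_powi_tri norm_mult by (intro mult_left_mono D) auto
  have s_bound: "norm (s L n) \<le> norm (q ^ (n * (n + 1) div 2)) * (D * E * B)" for L n
  proof (cases "n \<le> L")
    case True
    have "norm (bailey_weight n) * norm (qrec (int L - int n)) * norm (b n) \<le> norm (q ^ (n * (n + 1) div 2)) * D * E * B"
      using D(1) E(1) \<open>B \<ge> 0\<close> by (intro mult_mono bw E B) auto
    then show ?thesis using True by (simp only: s_def if_True norm_mult mult_ac)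
  next
    case False
    then show ?thesis using D(1) E(1) \<open>B \<ge> 0\<close> by (simp add: s_def)
  qed
  have left: "(\<lambda>n. bailey_weight n * b n) summable_on UNIV" "S \<longlonglongrightarrow> infsum (\<lambda>n. bailey_weight n * b n) UNIV"
    using has_sum_dominated[OF s s_lim s_bound h] by simp_all
  have "infsum (\<lambda>n. bailey_weight n * b n) UNIV
     = infsum (\<lambda>i. qpoch_inf (- q) q * (c i * q powi tri (j i + 1) + d i * q powi tri (k i + 1))) UNIV"
    using left(2) lim_right by (rule LIMSEQ_unique)
  also have "\<dots> = qpoch_inf (- q) q * (infsum (\<lambda>i. c i * q powi tri (j i + 1)) UNIV + infsum (\<lambda>i. d i * q powi tri (k i + 1)) UNIV)"
    using c d by (simp add: infsum_cmult_right' infsum_add)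
  finally show ?thesis
    using has_sum_imp_sums[OF has_sum_infsum[OF left(1)]] by simp
qed

section \<open>Quintuple products in base q^7\<close>

lemma q7: "qbase (q ^ 7)"
  using q0 q1 by unfold_locales (auto simp: norm_power power_less_one_iff)

lemma quint7:
  assumes "a > 0"
  shows "infsum (\<lambda>i. q powi (21 * tri i + (7 + 3 * a) * i)) UNIV
      - infsum (\<lambda>i. q powi (21 * tri i + (14 + 3 * a) * i + a)) UNIV
     = qpoch_inf (q powi a) (q ^ 7) * qpoch_inf (q powi (7 - a)) (q ^ 7) * qpoch_inf (q ^ 7) (q ^ 7)
     * (qpoch_inf (q powi (7 + 2 * a)) (q ^ 14) * qpoch_inf (q powi (7 - 2 * a)) (q ^ 14))"
proof -
  interpret p: qbase "q ^ 7" by (rule q7)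
  have p7: "(q ^ 7) powi k = q powi (7 * k)" for k
    using power_int_mult[of q 7 k] by simp
  have za: "(q powi a) powi k = q powi (a * k)" for k
    by (simp add: power_int_mult)
  have "q powi a * (q ^ 7) powi k \<noteq> -1" for k
  proof
    assume *: "q powi a * (q ^ 7) powi k = -1"
    have "q powi (2 * (a + 7 * k)) = (q powi (a + 7 * k)) * q powi (a + 7 * k)"
      by (rule powi_split) simp
    also have "q powi (a + 7 * k) = q powi a * q powi (7 * k)"
      by (rule powi_split) simp
    also have "\<dots> = -1" using * by (simp only: p7)
    finally have "q powi (2 * (a + 7 * k)) = 1" by simp
    \<comment> \<open>If this exponent were 0, the product in question would be 1 instead of -1.
      Otherwise its square being 1 contradicts \<open>powi_ne_1\<close>.\<close>
    moreover have "a + 7 * k \<noteq> 0"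
      using * q0 by (auto simp: p7 power_int_add[symmetric])
    ultimately show False using powi_ne_1[of "2 * (a + 7 * k)"] by simp
  qed
  then have sum: "infsum (p.quint_summand (q powi a)) UNIV = p.quint_prod (q powi a)"
    using q0 by (intro infsumI p.quintuple_product) auto
  have "p.quint_summand (q powi a) i = q powi (21 * tri i + (7 + 3 * a) * i) - q powi (21 * tri i + (14 + 3 * a) * i + a)" for i
  proof -
    have "q powi (21 * tri i + (7 + 3 * a) * i) = q powi (a * (3 * i)) * q powi (7 * (3 * tri i + i))"
      by (rule powi_split) (simp add: algebra_simps)
    moreover have "q powi (21 * tri i + (14 + 3 * a) * i + a) = q powi (21 * tri i + (7 + 3 * a) * i) * q powi (a + 7 * i)"
      by (rule powi_split) (simp add: algebra_simps)
    moreover have "q powi (a + 7 * i) = q powi a * q powi (7 * i)" by (rule powi_split) simp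
    ultimately show ?thesis
      unfolding p.quint_summand_def za p7 by (simp add: algebra_simps)
  qed
  then have summand: "p.quint_summand (q powi a) = (\<lambda>i. q powi (21 * tri i + (7 + 3 * a) * i) - q powi (21 * tri i + (14 + 3 * a) * i + a))"
    by (rule ext)
  have diff: "infsum (\<lambda>i. q powi (21 * tri i + (7 + 3 * a) * i) - q powi (21 * tri i + (14 + 3 * a) * i + a)) UNIV
     = infsum (\<lambda>i. q powi (21 * tri i + (7 + 3 * a) * i)) UNIV
      - infsum (\<lambda>i. q powi (21 * tri i + (14 + 3 * a) * i + a)) UNIV"
  proof -
    have "(\<lambda>i. q powi (21 * tri i + (7 + 3 * a) * i)) summable_on UNIV"
      "(\<lambda>i. q powi (21 * tri i + (14 + 3 * a) * i + a)) summable_on UNIV"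
      using tri_abs_summable[OF q0 q1, of 21 "7 + 3 * a" 0] tri_abs_summable[OF q0 q1, of 21 "14 + 3 * a" a]
      by (simp_all add: summable_on_iff_abs_summable_on_complex)
    from infsumI[OF has_sum_add[OF has_sum_infsum[OF this(1)] has_sum_uminusI[OF has_sum_infsum[OF this(2)]]]]
    show ?thesis by simp
  qed
  have prod: "p.quint_prod (q powi a) = qpoch_inf (q powi a) (q ^ 7) * qpoch_inf (q powi (7 - a)) (q ^ 7) * qpoch_inf (q ^ 7) (q ^ 7)
     * (qpoch_inf (q powi (7 + 2 * a)) (q ^ 14) * qpoch_inf (q powi (7 - 2 * a)) (q ^ 14))"
  proof -
    have "q ^ 7 / q powi a = q powi (7 - a)" "q powi (7 + 2 * a) = q ^ 7 * (q powi a)\<^sup>2"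
      "q ^ 7 / (q powi a)\<^sup>2 = q powi (7 - 2 * a)" "(q ^ 7)\<^sup>2 = q ^ 14"
      using q0 by (simp_all add: power_int_diff power_int_add power_int_mult[of q a 2, simplified mult.commute[of a]] flip: power_mult)
    then show ?thesis unfolding p.quint_prod_def by simp
  qed
  show ?thesis using sum unfolding summand diff prod .
qed

text \<open>The values at 2, 1 and 3 are the products that accompany (A, E), (B, F) and (C, G) in
  the theorem.\<close>

definition theta7 :: "int \<Rightarrow> complex" where
  "theta7 a = qpoch_inf (q powi a) (q ^ 7) * qpoch_inf (q powi (7 - a)) (q ^ 7) * qpoch_inf (q ^ 7) (q ^ 7)
     * (qpoch_inf (q powi (7 + 2 * a)) (q ^ 14) * qpoch_inf (q powi (7 - 2 * a)) (q ^ 14))"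

lemma infsum_int_reflect: "infsum (\<lambda>i. f (c - i)) UNIV = infsum f UNIV" for f :: "int \<Rightarrow> complex" and c :: int
  by (rule infsum_reindex_bij_witness[of _ "\<lambda>k. c - k" "\<lambda>k. c - k"]) auto

lemma tri_summable_on: "a > 0 \<Longrightarrow> (\<lambda>k. q powi (a * tri k + b * k + c)) summable_on UNIV"
  using tri_abs_summable[OF q0 q1, of a b c] by (simp add: summable_on_iff_abs_summable_on_complex)

lemma qrec_qpoch: "qrec 0 = qpoch q q n * qrec (int n)"
  using qpoch_inf_split[OF q1, of q n] q0 by (simp add: qrec_def power_int_add mult.commute)

lemma bailey_weight_odd:
  "bailey_weight n * qrec (2 * int n + 1) = qrec 0 * (q ^ (n * (n + 1) div 2) / (qpoch q (q\<^sup>2) (n + 1) * qpoch q q n))"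
proof -
  have *: "qrec 0 = qpoch q q (2 * n + 1) * qrec (2 * int n + 1)"
    using qrec_qpoch[of "2 * n + 1"] by (simp add: add.commute)
  then have "qpoch q q (2 * n + 1) \<noteq> 0" using qrec_nonzero[of 0] by auto
  then show ?thesis
    unfolding bailey_weight_def qpoch_powi_tri * unfolding qpoch_odd by (simp add: field_simps)
qed

lemma bailey_weight_even:
  "bailey_weight n * qrec (2 * int n) = qrec 0 * (q ^ (n * (n + 1) div 2) / (qpoch q (q\<^sup>2) n * qpoch q q n))"
proof -
  have *: "qrec 0 = qpoch q q (2 * n) * qrec (2 * int n)"
    using qrec_qpoch[of "2 * n"] by simp
  then have "qpoch q q (2 * n) \<noteq> 0" using qrec_nonzero[of 0] by auto
  then show ?thesis
    unfolding bailey_weight_def qpoch_powi_tri * unfolding qpoch_even by (simp add: field_simps)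
qed

section \<open>The two series and their initial values\<close>

definition S_term :: "nat \<Rightarrow> nat \<Rightarrow> complex" where
  "S_term m n = q ^ (n * (n + 2 * m + 1) div 2) / (qpoch q (q\<^sup>2) (n + 1) * qpoch q q n)"

definition T_term :: "nat \<Rightarrow> nat \<Rightarrow> complex" where
  "T_term m n = q ^ (n * (n + 2 * m + 1) div 2) / (qpoch q (q\<^sup>2) n * qpoch q q n)"

lemma exponent_split: "n * (n + 2 * m + 1) div 2 = n * (n + 1) div 2 + n * m" for n m :: nat
proof -
  have "n * (n + 2 * m + 1) = n * (n + 1) + 2 * (n * m)" by (simp add: algebra_simps)
  then show ?thesis by simp
qed

lemma S_term_eq: "S_term m n = (q ^ n) ^ m * S_term 0 n"
  unfolding S_term_def exponent_split by (simp add: power_add power_mult)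

lemma bounded_qrec_odd: "\<exists>B. \<forall>n. norm (q ^ n * qrec (2 * int n + 1)) \<le> B" "\<exists>B. \<forall>k. norm (qrec k) \<le> B"
proof -
  obtain C where C: "C > 0" "\<And>k. norm (qrec k) \<le> C" using qrec_bounded by blast
  have "norm (q ^ n * qrec (2 * int n + 1)) \<le> 1 * C" for n
    unfolding norm_mult norm_power using q1 C by (intro mult_mono power_le_one) auto
  then show "\<exists>B. \<forall>n. norm (q ^ n * qrec (2 * int n + 1)) \<le> B" by blast
  show "\<exists>B. \<forall>k. norm (qrec k) \<le> B" using C by blast
qed

definition kappa :: complex where
  "kappa = qpoch_inf (- q) q / qpoch_inf q q"

lemma kappa_sums:
  assumes "(\<lambda>n. qrec 0 * f n) sums (qpoch_inf (- q) q * c)"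
  shows "f sums (kappa * c)"
proof -
  have "qrec 0 \<noteq> 0" by (rule qrec_nonzero) simp
  then show ?thesis
    using sums_divide[OF assms, of "qrec 0"] by (simp add: kappa_def qrec_0)
qed

lemma S0_sums: "S_term 0 sums (kappa * theta7 2)"
proof (rule kappa_sums)
  have e1: "q powi (12 * tri i + 7 * i) * q powi tri (3 * i + 1) = q powi (21 * tri i + 13 * i)" for i
    by (rule powi_split[symmetric]) (simp add: tri_add tri_triple)
  have e2: "- (q powi (12 * tri i + 13 * i + 2)) * q powi tri (3 * i + 1 + 1) = - (q powi (21 * tri i + 22 * i + 3))" for i
    unfolding mult_minus_left by (rule arg_cong[where f = uminus], rule powi_split[symmetric]) (simp add: tri_add tri_triple)
  obtain B where B: "\<And>k. norm (qrec k) \<le> B" using bounded_qrec_odd by blast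
  have "(\<lambda>n. bailey_weight n * qrec (2 * int n + 1)) sums
     (qpoch_inf (- q) q * (infsum (\<lambda>i. q powi (21 * tri i + 13 * i)) UNIV + infsum (\<lambda>i. - (q powi (21 * tri i + 22 * i + 3))) UNIV))"
    using bailey_limit[OF bailey_pair_S0 B] tri_summable_on[of 21 13 0] tri_summable_on[of 21 22 3]
    unfolding e1 e2 by (simp add: summable_on_uminus)
  \<comment> \<open>The reflection i to -1 - i brings the second theta series into the form of
    \<open>quint7\<close> for a = 2, with 20 = 14 + 3 * 2; the first already has 13 = 7 + 3 *
    2.\<close>
  also have "infsum (\<lambda>i. - (q powi (21 * tri i + 22 * i + 3))) UNIV = - infsum (\<lambda>i. q powi (21 * tri i + 20 * i + 2)) UNIV"
  proof -
    have "tri (- 1 - i) = tri i + 2 * i + 1" for i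
      using tri_uminus[of "i + 1"] tri_add[of i 1] by (simp add: algebra_simps)
    then have "(\<lambda>i. q powi (21 * tri i + 20 * i + 2)) = (\<lambda>i. q powi (21 * tri (- 1 - i) + 22 * (- 1 - i) + 3))"
      by (simp add: algebra_simps)
    then show ?thesis
      using infsum_int_reflect[of "\<lambda>i. q powi (21 * tri i + 22 * i + 3)" "- 1"] by (simp add: infsum_uminus)
  qed
  finally show "(\<lambda>n. qrec 0 * S_term 0 n) sums (qpoch_inf (- q) q * theta7 2)"
    using quint7[of 2] by (simp add: bailey_weight_odd S_term_def theta7_def)
qed

lemma S1_sums: "S_term 1 sums (kappa * theta7 3)"
proof (rule kappa_sums)
  have e1: "q powi (12 * tri i + 10 * i) * q powi tri (3 * i + 1) = q powi (21 * tri i + 16 * i)" for i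
    by (rule powi_split[symmetric]) (simp add: tri_add tri_triple)
  have e2: "- (q powi (12 * tri i + 14 * i + 2)) * q powi tri (3 * i + 1 + 1) = - (q powi (21 * tri i + 23 * i + 3))" for i
    unfolding mult_minus_left by (rule arg_cong[where f = uminus], rule powi_split[symmetric]) (simp add: tri_add tri_triple)
  obtain B where B: "\<And>n. norm (q ^ n * qrec (2 * int n + 1)) \<le> B" using bounded_qrec_odd by blast
  have "(\<lambda>n. bailey_weight n * (q ^ n * qrec (2 * int n + 1))) sums
     (qpoch_inf (- q) q * (infsum (\<lambda>i. q powi (21 * tri i + 16 * i)) UNIV + infsum (\<lambda>i. - (q powi (21 * tri i + 23 * i + 3))) UNIV))"
    using bailey_limit[OF bailey_pair_S1 B] tri_summable_on[of 21 16 0] tri_summable_on[of 21 23 3]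
    unfolding e1 e2 by (simp add: summable_on_uminus)
  moreover have "bailey_weight n * (q ^ n * qrec (2 * int n + 1)) = qrec 0 * S_term 1 n" for n
  proof -
    have "bailey_weight n * (q ^ n * qrec (2 * int n + 1)) = q ^ n * (bailey_weight n * qrec (2 * int n + 1))"
      by (simp only: mult_ac)
    then show ?thesis
      unfolding bailey_weight_odd S_term_eq[of 1] by (simp add: S_term_def)
  qed
  ultimately show "(\<lambda>n. qrec 0 * S_term 1 n) sums (qpoch_inf (- q) q * theta7 3)"
    using quint7[of 3] by (simp add: infsum_uminus theta7_def)
qed

lemma T0_sums: "T_term 0 sums (kappa * theta7 1)"
proof (rule kappa_sums)
  have t: "tri (- 3 * i + 1) = 9 * tri i + 3 * i" for i
  proof -
    have "- 3 * i = - (3 * i)" by simp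
    then show ?thesis by (simp only: tri_add tri_uminus tri_triple tri_simps)
  qed
  have e1: "q powi (12 * tri i + 7 * i) * q powi tri (- 3 * i + 1) = q powi (21 * tri i + 10 * i)" for i
    unfolding t by (rule powi_split[symmetric]) simp
  have e2: "- (q powi (12 * tri i + i + 1)) * q powi tri (- 3 * i + 1) = - (q powi (21 * tri i + 4 * i + 1))" for i
    unfolding t unfolding mult_minus_left by (rule arg_cong[where f = uminus], rule powi_split[symmetric]) simp
  obtain B where B: "\<And>k. norm (qrec k) \<le> B" using bounded_qrec_odd by blast
  have "(\<lambda>n. bailey_weight n * qrec (2 * int n)) sums
     (qpoch_inf (- q) q * (infsum (\<lambda>i. q powi (21 * tri i + 10 * i)) UNIV + infsum (\<lambda>i. - (q powi (21 * tri i + 4 * i + 1))) UNIV))"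
    using bailey_limit[OF bailey_pair_T0 B] tri_summable_on[of 21 10 0] tri_summable_on[of 21 4 1]
    unfolding e1 e2 by (simp add: summable_on_uminus)
  \<comment> \<open>Here i to -i is the right reflection: it gives 17 = 14 + 3 * 1, matching
    \<open>quint7\<close> for a = 1.\<close>
  also have "infsum (\<lambda>i. - (q powi (21 * tri i + 4 * i + 1))) UNIV = - infsum (\<lambda>i. q powi (21 * tri i + 17 * i + 1)) UNIV"
  proof -
    have "(\<lambda>i. q powi (21 * tri i + 17 * i + 1)) = (\<lambda>i. q powi (21 * tri (0 - i) + 4 * (0 - i) + 1))"
      by (simp add: tri_uminus algebra_simps)
    then show ?thesis
      using infsum_int_reflect[of "\<lambda>i. q powi (21 * tri i + 4 * i + 1)" 0] by (simp add: infsum_uminus)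
  qed
  finally show "(\<lambda>n. qrec 0 * T_term 0 n) sums (qpoch_inf (- q) q * theta7 1)"
    using quint7[of 1] by (simp add: bailey_weight_even T_term_def theta7_def)
qed

section \<open>Recurrences in m and the coefficient sequences\<close>

definition S_sum :: "nat \<Rightarrow> complex" where
  "S_sum m = (\<Sum>n. S_term m n)"

lemma S_sums: "S_term m sums S_sum m"
proof -
  obtain C where C: "C > 0" "\<And>k. norm (qrec k) \<le> C" using qrec_bounded by blast
  obtain D where D: "D > 0" "\<And>n. norm (qpoch (- q) q n) \<le> D" using qpoch_bounded by blast
  have nz: "qrec 0 \<noteq> 0" by (rule qrec_nonzero) simp
  have S0: "S_term 0 n = q ^ (n * (n + 1) div 2) * (qpoch (- q) q n * qrec (2 * int n + 1) / qrec 0)" for n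
  proof -
    have "S_term 0 n = bailey_weight n * qrec (2 * int n + 1) / qrec 0"
      using bailey_weight_odd[of n] nz by (simp add: S_term_def)
    then show ?thesis unfolding bailey_weight_def qpoch_powi_tri by simp
  qed
  have "summable (S_term m)"
  proof (rule summable_comparison_test')
    show "summable (\<lambda>n. norm (q ^ (n * (n + 1) div 2)) * (D * C / norm (qrec 0)))"
      using tri_power_summable by (rule summable_mult2)
    fix n :: nat assume "n \<ge> 0"
    have "norm ((q ^ n) ^ m) \<le> 1"
      unfolding norm_power using q1 by (intro power_le_one) auto
    then have "norm (S_term m n) \<le> 1 * norm (S_term 0 n)"
      unfolding S_term_eq[of m] norm_mult by (intro mult_right_mono) auto
    also have "norm (S_term 0 n) \<le> norm (q ^ (n * (n + 1) div 2)) * (D * C / norm (qrec 0))"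
      unfolding S0 norm_mult norm_divide using C D
      by (intro mult_left_mono divide_right_mono mult_mono) (auto intro: less_imp_le)
    finally show "norm (S_term m n) \<le> norm (q ^ (n * (n + 1) div 2)) * (D * C / norm (qrec 0))" by simp
  qed
  then show ?thesis unfolding S_sum_def by (rule summable_sums)
qed

lemma qpoch_nonzero: "qpoch q q n \<noteq> 0" "qpoch q (q\<^sup>2) n \<noteq> 0"
proof -
  have "qpoch q q (2 * n) \<noteq> 0"
    using qrec_qpoch[of "2 * n"] qrec_nonzero[of 0] by auto
  then show "qpoch q q n \<noteq> 0" "qpoch q (q\<^sup>2) n \<noteq> 0" by (simp_all add: qpoch_even)
qed

lemma T_sums: "T_term m sums (S_sum m - q * S_sum (m + 2))"
proof -
  have "T_term m n = S_term m n - q * S_term (m + 2) n" for n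
  proof -
    have "T_term m n = (1 - q * (q\<^sup>2) ^ n) * S_term m n"
      using qpoch_nonzero[of "n + 1"] qpoch_nonzero[of n]
      by (simp add: T_term_def S_term_def qpoch_Suc)
    moreover have "(q\<^sup>2) ^ n = (q ^ n)\<^sup>2" by (simp add: mult.commute flip: power_mult)
    then have "S_term (m + 2) n = (q\<^sup>2) ^ n * S_term m n"
      unfolding S_term_eq[of "m + 2"] S_term_eq[of m] by (simp only: power_add mult_ac)
    ultimately show ?thesis by (simp add: algebra_simps)
  qed
  then show ?thesis using sums_diff[OF S_sums sums_mult[OF S_sums, of q]] by presburger
qed

lemma S_sum_rec: "S_sum m - S_sum (m + 1) - q * S_sum (m + 2) + q * S_sum (m + 3) = q ^ (m + 1) * S_sum (m + 1)"
proof -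
  define D where "D n = S_term m n - S_term (m + 1) n - q * S_term (m + 2) n + q * S_term (m + 3) n" for n
  have D: "D n = S_term m n * ((1 - q ^ n) * (1 - q * (q\<^sup>2) ^ n))" for n
  proof -
    have "(q\<^sup>2) ^ n = (q ^ n)\<^sup>2" by (simp add: mult.commute flip: power_mult)
    then show ?thesis
      unfolding D_def S_term_eq[of "m + 1"] S_term_eq[of "m + 2"] S_term_eq[of "m + 3"] S_term_eq[of m]
      by (simp add: power_add power2_eq_square power3_eq_cube algebra_simps)
  qed
  have "D (Suc n) = q ^ (m + 1) * S_term (m + 1) n" for n
  proof -
    have nz: "1 - q * q ^ n \<noteq> 0" "1 - q * (q\<^sup>2) ^ (n + 1) \<noteq> 0"
      using qpoch_nonzero(1)[of "Suc n"] qpoch_nonzero(2)[of "Suc (Suc n)"] by (simp_all add: qpoch_Suc)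
    \<comment> \<open>The triangular number grows by n + 1. Its part n raises m to m + 1 in the
      exponent; the remaining 1, together with the m from (n + 1)m, gives the factor
      q^(m+1).\<close>
    have "Suc n * (Suc n + 1) div 2 = n * (n + 1) div 2 + (n + 1)"
    proof -
      have "Suc n * (Suc n + 1) = n * (n + 1) + 2 * (n + 1)" by simp
      then show ?thesis by (simp only: div_mult_self2)
    qed
    then have "Suc n * (Suc n + 2 * m + 1) div 2 = n * (n + 2 * (m + 1) + 1) div 2 + (m + 1)"
      unfolding exponent_split by simp
    moreover have "qpoch q (q\<^sup>2) (Suc n + 1) = qpoch q (q\<^sup>2) (n + 1) * (1 - q * (q\<^sup>2) ^ (n + 1))"
      "qpoch q q (Suc n) = qpoch q q n * (1 - q * q ^ n)" by (simp_all add: qpoch_Suc)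
    ultimately have "S_term m (Suc n) = q ^ (m + 1) * S_term (m + 1) n / ((1 - q * q ^ n) * (1 - q * (q\<^sup>2) ^ (n + 1)))"
      unfolding S_term_def by (simp add: power_add mult_ac)
    then show ?thesis using nz unfolding D by simp
  qed
  then have "(\<lambda>n. D (Suc n)) sums (q ^ (m + 1) * S_sum (m + 1))"
    using sums_mult[OF S_sums] by presburger
  \<comment> \<open>The factor 1 - q^n kills n = 0, so the shift of n loses nothing.\<close>
  moreover have "D 0 = 0" unfolding D by simp
  ultimately have "D sums (q ^ (m + 1) * S_sum (m + 1))"
    using sums_Suc_iff[of D] by simp
  moreover have "D sums (S_sum m - S_sum (m + 1) - q * S_sum (m + 2) + q * S_sum (m + 3))"
    unfolding D_def by (intro sums_add sums_diff sums_mult S_sums)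
  ultimately show ?thesis using sums_unique2 by blast
qed

lemma S_sum_0: "S_sum 0 = kappa * theta7 2"
  using S_sums S0_sums by (rule sums_unique2)

lemma S_sum_1: "S_sum 1 = kappa * theta7 3"
  using S_sums S1_sums by (rule sums_unique2)

lemma S_sum_2: "S_sum 0 - q * S_sum 2 = kappa * theta7 1"
  using sums_unique2[OF T_sums[of 0] T0_sums] by (simp add: numeral_2_eq_2)

lemma S_sum_rec_0: "S_sum 0 - S_sum 1 - q * S_sum 2 + q * S_sum 3 = q * S_sum 1"
  using S_sum_rec[of 0] by (simp add: numeral_2_eq_2)

lemma S_sum_rec_1: "S_sum 1 - S_sum 2 - q * S_sum 3 + q * S_sum 4 = q\<^sup>2 * S_sum 2"
proof -
  have "1 + 1 = (2::nat)" "1 + 2 = (3::nat)" "1 + 3 = (4::nat)" by simp_all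
  then show ?thesis using S_sum_rec[of 1] by (simp only:)
qed

text \<open>Multiplying \<open>S_sum_rec\<close> by q^(m+2) gives the recursion of A, B, C for q^m
  S_m, so only the initial values at m = 0, 1, 2 have to agree.\<close>

lemma S_sum_combination:
  assumes rec: "\<And>X m. X \<in> {A, B, C} \<Longrightarrow> m \<ge> 3 \<Longrightarrow>
      X m = q * X (m - 1) + (q + q ^ (m - 1)) * X (m - 2) - q ^ 2 * X (m - 3)"
    and "A 0 = 1" "A 1 = 0" "A 2 = q" "B 0 = 0" "B 1 = 0" "B 2 = - q" "C 0 = 0" "C 1 = q" "C 2 = 0"
  shows "q ^ m * S_sum m = kappa * (theta7 2 * A m + theta7 1 * B m + theta7 3 * C m)"
proof (induction m rule: less_induct)
  case (less m)
  consider "m = 0" | "m = 1" | "m = 2" | k where "m = k + 3"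
    by (metis One_nat_def add.commute less_2_cases_iff less_Suc_eq_0_disj linorder_not_less le_Suc_ex numeral_2_eq_2 numeral_3_eq_3 not_less_eq less_Suc_eq)
  then show ?case
  proof cases
    case 1
    then show ?thesis using assms S_sum_0 by simp
  next
    case 2
    then show ?thesis using assms S_sum_1 by simp
  next
    case 3
    have "q ^ 2 * S_sum 2 = q * (kappa * theta7 2 - kappa * theta7 1)"
      unfolding S_sum_2[symmetric] S_sum_0[symmetric] by algebra
    then show ?thesis using 3 assms by (simp add: algebra_simps)
  next
    case 4
    have r: "X (k + 3) = q * X (k + 2) + (q + q ^ (k + 2)) * X (k + 1) - q ^ 2 * X k" if "X \<in> {A, B, C}" for X
      using rec[OF that, of "k + 3"] by simp
    have "q ^ (k + 3) * S_sum (k + 3) = q * (q ^ (k + 2) * S_sum (k + 2)) + (q + q ^ (k + 2)) * (q ^ (k + 1) * S_sum (k + 1)) - q ^ 2 * (q ^ k * S_sum k)"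
    proof -
      define Q where "Q = q ^ k"
      from S_sum_rec[of k] show ?thesis
        unfolding power_add power_one_right Q_def[symmetric] by algebra
    qed
    also have "\<dots> = kappa * (theta7 2 * A m + theta7 1 * B m + theta7 3 * C m)"
    proof -
      define Q where "Q = q ^ (k + 2)"
      have l: "k < m" "k + 1 < m" "k + 2 < m" by (simp_all add: 4)
      have mem: "A \<in> {A, B, C}" "B \<in> {A, B, C}" "C \<in> {A, B, C}" by simp_all
      note r' = r[OF mem(1)] r[OF mem(2)] r[OF mem(3)]
      show ?thesis
        unfolding less[OF l(1)] less[OF l(2)] less[OF l(3)] unfolding 4 r' Q_def[symmetric] by algebra
    qed
    finally show ?thesis unfolding 4 .
  qed
qed

text \<open>For T_m = S_m - q S_(m+2), q times the recurrence of S at k minus the one at k + 2 is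
  the recursion of E, F, G.\<close>

lemma T_sum_combination:
  assumes rec: "\<And>X m. X \<in> {E, F, G} \<Longrightarrow> m \<ge> 3 \<Longrightarrow>
      X m = X (m - 1) + (q + q ^ (m - 1)) * X (m - 2) - q * X (m - 3)"
    and "E 0 = 0" "E 1 = 0" "E 2 = - q" "F 0 = 1" "F 1 = 1" "F 2 = 1 + q" "G 0 = 0" "G 1 = - q" "G 2 = - q"
  shows "S_sum m - q * S_sum (m + 2) = kappa * (theta7 2 * E m + theta7 1 * F m + theta7 3 * G m)"
proof (induction m rule: less_induct)
  case (less m)
  consider "m = 0" | "m = 1" | "m = 2" | k where "m = k + 3"
    by (metis One_nat_def add.commute less_2_cases_iff less_Suc_eq_0_disj linorder_not_less le_Suc_ex numeral_2_eq_2 numeral_3_eq_3 not_less_eq less_Suc_eq)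
  then show ?case
  proof cases
    case 1
    then show ?thesis using assms S_sum_2 by (simp add: numeral_2_eq_2)
  next
    case 2
    have "S_sum 1 - q * S_sum 3 = kappa * theta7 1 - q * (kappa * theta7 3)"
      using S_sum_rec_0 unfolding S_sum_2[symmetric] S_sum_1[symmetric] by (simp add: algebra_simps)
    then show ?thesis using 2 assms by (simp add: algebra_simps numeral_3_eq_3)
  next
    case 3
    \<comment> \<open>The recurrence at 1 gives T_2 = T_1 - q^2 S_2; then T_1 = T_0 - q S_1 and q
      S_2 = S_0 - T_0 are inserted.\<close>
    have "S_sum 2 - q * S_sum 4 = - q * (kappa * theta7 2) + (1 + q) * (kappa * theta7 1) - q * (kappa * theta7 3)"
      using S_sum_rec_0 S_sum_rec_1 unfolding S_sum_2[symmetric] S_sum_1[symmetric] S_sum_0[symmetric]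
      by algebra
    then show ?thesis using 3 assms by (simp add: algebra_simps)
  next
    case 4
    have r: "X (k + 3) = X (k + 2) + (q + q ^ (k + 2)) * X (k + 1) - q * X k" if "X \<in> {E, F, G}" for X
      using rec[OF that, of "k + 3"] by simp
    have e: "k + 2 + 1 = k + 3" "k + 2 + 2 = k + 4" "k + 2 + 3 = k + 5" "k + 3 + 2 = k + 5" "k + 1 + 2 = k + 3" by simp_all
    have "S_sum (k + 3) - q * S_sum (k + 3 + 2) = (S_sum (k + 2) - q * S_sum (k + 2 + 2))
        + (q + q ^ (k + 2)) * (S_sum (k + 1) - q * S_sum (k + 1 + 2)) - q * (S_sum k - q * S_sum (k + 2))"
    proof -
      define Q where "Q = q ^ k"
      from S_sum_rec[of k] S_sum_rec[of "k + 2"] show ?thesis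
        unfolding e power_add power_one_right Q_def[symmetric] by algebra
    qed
    also have "\<dots> = kappa * (theta7 2 * E m + theta7 1 * F m + theta7 3 * G m)"
    proof -
      define Q where "Q = q ^ (k + 2)"
      have l: "k < m" "k + 1 < m" "k + 2 < m" by (simp_all add: 4)
      have mem: "E \<in> {E, F, G}" "F \<in> {E, F, G}" "G \<in> {E, F, G}" by simp_all
      note r' = r[OF mem(1)] r[OF mem(2)] r[OF mem(3)]
      show ?thesis
        unfolding less[OF l(1)] less[OF l(2)] less[OF l(3)] unfolding 4 r' Q_def[symmetric] by algebra
    qed
    finally show ?thesis unfolding 4 .
  qed
qed

lemma theta7_qpochs:
  "theta7 2 = qpochs_inf [q ^ 2, q ^ 5, q ^ 7] (q ^ 7) * qpochs_inf [q ^ 3, q ^ 11] (q ^ 14)"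
  "theta7 1 = qpochs_inf [q, q ^ 6, q ^ 7] (q ^ 7) * qpochs_inf [q ^ 5, q ^ 9] (q ^ 14)"
  "theta7 3 = qpochs_inf [q ^ 3, q ^ 4, q ^ 7] (q ^ 7) * qpochs_inf [q, q ^ 13] (q ^ 14)"
  by (simp_all add: theta7_def qpochs_inf_def)

end

theorem theorem3p3:
  fixes q :: complex and A B C E F G :: "nat \<Rightarrow> complex"
  assumes q: "0 < norm q" "norm q < 1"
    and rec_ABC: "\<forall>X\<in>{A, B, C}. \<forall>m\<ge>3.
      X m = q * X (m - 1) + (q + q ^ (m - 1)) * X (m - 2) - q ^ 2 * X (m - 3)"
    and init_A: "A 0 = 1" "A 1 = 0" "A 2 = q"
    and init_B: "B 0 = 0" "B 1 = 0" "B 2 = - q"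
    and init_C: "C 0 = 0" "C 1 = q" "C 2 = 0"
    and rec_EFG: "\<forall>X\<in>{E, F, G}. \<forall>m\<ge>3.
      X m = X (m - 1) + (q + q ^ (m - 1)) * X (m - 2) - q * X (m - 3)"
    and init_E: "E 0 = 0" "E 1 = 0" "E 2 = - q"
    and init_F: "F 0 = 1" "F 1 = 1" "F 2 = 1 + q"
    and init_G: "G 0 = 0" "G 1 = - q" "G 2 = - q"
  shows
    "(\<forall>m::nat.
        (\<lambda>n. q ^ (n * (n + 2 * m + 1) div 2) / (qpoch q (q ^ 2) (n + 1) * qpoch q q n)) sums
           (q powi (- int m) * qpochs_inf [q ^ 2, q ^ 5, q ^ 7] (q ^ 7) * qpochs_inf [q ^ 3, q ^ 11] (q ^ 14)
              * qpoch_inf (- q) q / qpoch_inf q q * A m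
            + q powi (- int m) * qpochs_inf [q, q ^ 6, q ^ 7] (q ^ 7) * qpochs_inf [q ^ 5, q ^ 9] (q ^ 14)
              * qpoch_inf (- q) q / qpoch_inf q q * B m
            + q powi (- int m) * qpochs_inf [q ^ 3, q ^ 4, q ^ 7] (q ^ 7) * qpochs_inf [q, q ^ 13] (q ^ 14)
              * qpoch_inf (- q) q / qpoch_inf q q * C m))
   \<and> (\<forall>m::nat.
        (\<lambda>n. q ^ (n * (n + 2 * m + 1) div 2) / (qpoch q (q ^ 2) n * qpoch q q n)) sums
           (qpochs_inf [q ^ 2, q ^ 5, q ^ 7] (q ^ 7) * qpochs_inf [q ^ 3, q ^ 11] (q ^ 14)
              * qpoch_inf (- q) q / qpoch_inf q q * E m
            + qpochs_inf [q, q ^ 6, q ^ 7] (q ^ 7) * qpochs_inf [q ^ 5, q ^ 9] (q ^ 14)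
              * qpoch_inf (- q) q / qpoch_inf q q * F m
            + qpochs_inf [q ^ 3, q ^ 4, q ^ 7] (q ^ 7) * qpochs_inf [q, q ^ 13] (q ^ 14)
              * qpoch_inf (- q) q / qpoch_inf q q * G m))"
proof -
  interpret qbase q
    using q by unfold_locales auto
  have powi: "q powi (- int m) * q ^ m = 1" for m
    using q by (simp add: power_int_minus)
  have "S_sum m = q powi (- int m) * qpochs_inf [q ^ 2, q ^ 5, q ^ 7] (q ^ 7) * qpochs_inf [q ^ 3, q ^ 11] (q ^ 14)
              * qpoch_inf (- q) q / qpoch_inf q q * A m
            + q powi (- int m) * qpochs_inf [q, q ^ 6, q ^ 7] (q ^ 7) * qpochs_inf [q ^ 5, q ^ 9] (q ^ 14)
              * qpoch_inf (- q) q / qpoch_inf q q * B m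
            + q powi (- int m) * qpochs_inf [q ^ 3, q ^ 4, q ^ 7] (q ^ 7) * qpochs_inf [q, q ^ 13] (q ^ 14)
              * qpoch_inf (- q) q / qpoch_inf q q * C m" for m
  proof -
    have "S_sum m = q powi (- int m) * (q ^ m * S_sum m)"
      by (simp only: powi mult.assoc[symmetric] mult_1)
    also have "q ^ m * S_sum m = kappa * (theta7 2 * A m + theta7 1 * B m + theta7 3 * C m)"
      by (rule S_sum_combination) (use rec_ABC init_A init_B init_C in auto)
    finally show ?thesis
      by (simp add: kappa_def theta7_qpochs add_divide_distrib distrib_left distrib_right mult_ac)
  qed
  moreover have "S_sum m - q * S_sum (m + 2) = qpochs_inf [q ^ 2, q ^ 5, q ^ 7] (q ^ 7) * qpochs_inf [q ^ 3, q ^ 11] (q ^ 14)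
              * qpoch_inf (- q) q / qpoch_inf q q * E m
            + qpochs_inf [q, q ^ 6, q ^ 7] (q ^ 7) * qpochs_inf [q ^ 5, q ^ 9] (q ^ 14)
              * qpoch_inf (- q) q / qpoch_inf q q * F m
            + qpochs_inf [q ^ 3, q ^ 4, q ^ 7] (q ^ 7) * qpochs_inf [q, q ^ 13] (q ^ 14)
              * qpoch_inf (- q) q / qpoch_inf q q * G m" for m
  proof -
    have "S_sum m - q * S_sum (m + 2) = kappa * (theta7 2 * E m + theta7 1 * F m + theta7 3 * G m)"
      by (rule T_sum_combination) (use rec_EFG init_E init_F init_G in auto)
    then show ?thesis
      by (simp add: kappa_def theta7_qpochs add_divide_distrib distrib_left distrib_right mult_ac)
  qed
  ultimately show ?thesis
    using S_sums T_sums unfolding S_term_def[abs_def] T_term_def[abs_def] by simp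
qed

end
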